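(* Let $(A,\{\mu_k\}_{k\ge1})$ be an $A_\infty$-algebra, $(M,\{\eta_k\}_{k\ge1})$ a representation of it and $P=\{P_k\}_{k\ge1}$ a homotopy relative averaging operator on $M$ over $A$ (i.e. $M\xrightarrow{\{P_k\}}A$ is a homotopy relative averaging algebra). Then $(M,\{\pi_k^P\}_{k\ge1})$ is a $Diass_\infty$-algebra, where $$\pi_k^P(y;u_1,\dots,u_k)=\big(e^{\{\![-,P]\!\}}\pi\big)(y;u_1,\dots,u_k),\qquad k\ge1,\ y\in Y_k,\ u_1,\dots,u_k\in M,$$ and $\pi=\sum_k\pi_k$ is the $Diass_\infty$-structure on $A\oplus M$ defined in the context.
   Context: Everything is over a field $\mathbf k$ of characteristic $0$; graded means $\mathbb Z$-graded. $A_\infty$-algebra: a graded vector space $A$ with degree $1$ maps $\mu_k:A^{\otimes k}\to A$, $k\ge1$, such that for all $n\ge 1$ and homogeneous $a_1,\dots,a_n$, $$\sum_{k+l=n+1}\sum_{i=1}^{n-l+1}(-1)^{|a_1|+\cdots+|a_{i-1}|}\mu_k(a_1,\dots,a_{i-1},\mu_l(a_i,\dots,a_{i+l-1}),a_{i+l},\dots,a_n)=0.$$ A representation is a graded vector space $M$ with degree $1$ maps $\eta_k:\mathcal A^{k-1,1}\to M$, $k\ge1$ ($\mathcal A^{k-1,1}$ is the direct sum of all tensor products of $k-1$ copies of $A$ and one of $M$, in any order), satisfying the same identities whenever exactly one $a_j$ lies in $M$, with each $\mu$ having an argument in $M$ replaced by the corresponding $\eta$. Trees. $Y_n$ ($n\ge1$)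 is the set of planar binary trees with $n$ trivalent vertices, one root and $n+1$ leaves labelled $0,\dots,n$ from left to right; $Y_0=\{|\}$; $y_1\vee y_2$ is grafting at a new root vertex, and each $y\in Y_k$ is uniquely $y_1\vee y_2$ with $y_1\in Y_{i-1},y_2\in Y_{k-i}$ for some $1\le i\le k$. $R_0^{k;i,l}:Y_{k+l-1}\to Y_k$ deletes the leaves labelled $i,\dots,i+l-2$; $R_i^{k;i,l}:Y_{k+l-1}\to Y_l$ deletes the leaves labelled $0,\dots,i-2$ and $i+l,\dots,k+l-1$ (original labels). $Diass_\infty$-algebra: a graded vector space $D$ with degree $1$ maps $\pi_k:\mathbf k[Y_k]\otimes D^{\otimes k}\to D$, $k\ge1$, such that for all $n\ge1$, $y\in Y_n$ and homogeneous $a_1,\dots,a_n\in D$, $$\sum_{k+l=n+1}\sum_{i=1}^{n-l+1}(-1)^{|a_1|+\cdots+|a_{i-1}|}\pi_k\big(R_0^{k;i,l}(y);a_1,\dots,a_{i-1},\pi_l(R_i^{k;i,l}(y);a_i,\dots,a_{i+l-1}),a_{i+l},\dots,a_n\big)=0.$$ Bracket. For a graded vector space $D$, $CY^n(D,D)$ is the space of sums $\pi=\sum_{k\ge1}\pi_k$ with $\pi_k:\mathbf k[Y_k]\otimes D^{\otimes k}\to D$ of degree $n$. For $\pi\in CY^m(D,D)$, $\varpi\in CY^n(D,D)$, $\{\![\pi,\varpi]\!\}=\sum_{s\ge1}\sum_{k+l=s+1}(\pi_k\diamond\varpi_l-(-1)^{mn}\varpi_l\diamond\pi_k)$, where $$(\pi_k\diamond\varpi_l)(y;a_1,\dots,a_s)=\sum_{i=1}^{s-l+1}(-1)^{n(|a_1|+\cdots+|a_{i-1}|)}\pi_k\big(R_0^{k;i,l}(y);a_1,\dots,a_{i-1},\varpi_l(R_i^{k;i,l}(y);a_i,\dots,a_{i+l-1}),a_{i+l},\dots,a_s\big).$$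 This makes $\oplus_nCY^n(D,D)$ a graded Lie algebra. Homotopy relative averaging operators. On $A\oplus M$ let $\pi=\sum_k\pi_k\in CY^1(A\oplus M,A\oplus M)$, $$\pi_k(y;(a_1,u_1),\dots,(a_k,u_k))=\big(\mu_k(a_1,\dots,a_k),\eta_k(a_1,\dots,a_{i-1},u_i,a_{i+1},\dots,a_k)\big)$$ for $y=y_1\vee y_2$ with $y_1\in Y_{i-1},y_2\in Y_{k-i}$; this is a $Diass_\infty$-structure, so $\{\![\pi,\pi]\!\}=0$. Let $\mathfrak a=\oplus_nCY^n(M,A)\subset\oplus_nCY^n(A\oplus M,A\oplus M)$ be the subspace of maps with all inputs in $M$ and output in $A$ (extended by zero), and $p$ the projection onto $\mathfrak a$. A homotopy relative averaging operator is a collection $P=\{P_k:\mathbf k[Y_k]\otimes M^{\otimes k}\to A\}_{k\ge1}$ of degree $0$ maps such that $P=\sum_kP_k$ is a Maurer-Cartan element of the $L_\infty$-algebra $\mathfrak a$ with $l_k(\gamma_1,\dots,\gamma_k)=p\{\![\cdots\{\![\{\![\pi,\gamma_1]\!\},\gamma_2]\!\},\dots,\gamma_k]\!\}$; equivalently $p(e^{\{\![-,P]\!\}}\pi)=0$, where $e^{\{\![-,P]\!\}}\pi=\sum_{m\ge0}\frac1{m!}\{\![\cdots\{\![\{\![\pi,P]\!\},P]\!\},\dots,P]\!\}$ ($m$ brackets). *)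

theory Defs
  imports Complex_Main "HOL-Library.Product_Plus" "HOL-Library.Groups_Big_Fun"
begin

section \<open>Graded vector spaces and multilinear maps\<close>

locale graded_space = vector_space scale
  for scale :: "'k::field_char_0 \<Rightarrow> 'v::ab_group_add \<Rightarrow> 'v" +
  fixes V :: "int \<Rightarrow> 'v set"
  assumes subspace_component: "subspace (V d)"
    and decomposition: "\<exists>!f. (\<forall>d. f d \<in> V d) \<and> finite {d. f d \<noteq> 0} \<and> v = (\<Sum>d. f d)"

definition component :: "(int \<Rightarrow> 'v::ab_group_add set) \<Rightarrow> int \<Rightarrow> 'v \<Rightarrow> 'v" where
  "component V d v =
     (THE f. (\<forall>d. f d \<in> V d) \<and> finite {d. f d \<noteq> 0} \<and> v = (\<Sum>d. f d)) d"

text \<open>The linear extension of \<open>a \<mapsto> (-1)\<^sup>n\<^sup>|\<^sup>a\<^sup>| a\<close> from homogeneous elements.  It lets the sign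
  of the bracket below be written for arbitrary, not only homogeneous, arguments
  (see \<open>diamond_homogeneous\<close>).\<close>

definition koszul_sign ::
    "('k::field_char_0 \<Rightarrow> 'v::ab_group_add \<Rightarrow> 'v) \<Rightarrow> (int \<Rightarrow> 'v set) \<Rightarrow> int \<Rightarrow> 'v \<Rightarrow> 'v" where
  "koszul_sign scale V n v = (\<Sum>d. scale ((-1) powi (n * d)) (component V d v))"

abbreviation homogeneous :: "(int \<Rightarrow> 'v set) \<Rightarrow> 'v list \<Rightarrow> int list \<Rightarrow> bool" where
  "homogeneous V \<equiv> list_all2 (\<lambda>x d. x \<in> V d)"

text \<open>A linear map of degree \<open>n\<close> from the \<open>k\<close>-th tensor power of a graded space to another
  graded space is a function on lists, considered only on lists of length \<open>k\<close>.\<close>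

definition graded_multilinear ::
    "('k::field_char_0 \<Rightarrow> 'v::ab_group_add \<Rightarrow> 'v) \<Rightarrow> (int \<Rightarrow> 'v set) \<Rightarrow>
     ('k \<Rightarrow> 'w::ab_group_add \<Rightarrow> 'w) \<Rightarrow> (int \<Rightarrow> 'w set) \<Rightarrow> int \<Rightarrow> nat \<Rightarrow> ('v list \<Rightarrow> 'w) \<Rightarrow> bool" where
  "graded_multilinear scale V scale' W n k f \<longleftrightarrow>
     (\<forall>xs zs. length xs + 1 + length zs = k \<longrightarrow>
        Vector_Spaces.linear scale scale' (\<lambda>y. f (xs @ y # zs))) \<and>
     (\<forall>xs ds. length xs = k \<longrightarrow> homogeneous V xs ds \<longrightarrow> f xs \<in> W (sum_list ds + n))"

text \<open>\<open>plug i l g (a\<^sub>1,\<dots>,a\<^sub>n) = (a\<^sub>1,\<dots>,a\<^sub>i\<^sub>-\<^sub>1, g(a\<^sub>i,\<dots>,a\<^sub>i\<^sub>+\<^sub>l\<^sub>-\<^sub>1), a\<^sub>i\<^sub>+\<^sub>l,\<dots>,a\<^sub>n)\<close>\<close>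

definition plug :: "nat \<Rightarrow> nat \<Rightarrow> ('v list \<Rightarrow> 'v) \<Rightarrow> 'v list \<Rightarrow> 'v list" where
  "plug i l g xs = take (i - 1) xs @ g (take l (drop (i - 1) xs)) # drop (i - 1 + l) xs"


section \<open>\<open>A\<^sub>\<infinity>\<close>-algebras and representations\<close>

text \<open>The maps \<open>\<mu>\<^sub>k\<close>, \<open>k \<ge> 1\<close>, are one function on lists, \<open>\<mu>\<^sub>k\<close> being its restriction to length \<open>k\<close>.
  In all double sums below \<open>k = n + 1 - l\<close>.\<close>

locale ainf_algebra = graded_space scale V
  for scale :: "'k::field_char_0 \<Rightarrow> 'a::ab_group_add \<Rightarrow> 'a" and V +
  fixes \<mu> :: "'a list \<Rightarrow> 'a"
  assumes \<mu>_multilinear: "k \<ge> 1 \<Longrightarrow> graded_multilinear scale V scale V 1 k \<mu>"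
    and ainf_identity:
      "n \<ge> 1 \<Longrightarrow> length xs = n \<Longrightarrow> homogeneous V xs ds \<Longrightarrow>
       (\<Sum>l = 1..n. \<Sum>i = 1..n - l + 1.
          scale ((-1) powi (sum_list (take (i - 1) ds))) (\<mu> (plug i l \<mu> xs))) = 0"

text \<open>\<open>\<eta> as u bs\<close> stands for \<open>\<eta>\<^sub>k(a\<^sub>1,\<dots>,a\<^sub>j\<^sub>-\<^sub>1,u,a\<^sub>j\<^sub>+\<^sub>1,\<dots>,a\<^sub>k)\<close> with \<open>as = (a\<^sub>1,\<dots>,a\<^sub>j\<^sub>-\<^sub>1)\<close> and
  \<open>bs = (a\<^sub>j\<^sub>+\<^sub>1,\<dots>,a\<^sub>k)\<close>, so the summands of \<open>\<A>\<^sup>k\<^sup>-\<^sup>1\<^sup>,\<^sup>1\<close> are indexed by the pairs of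
  lengths of \<open>as\<close> and \<open>bs\<close>.\<close>

definition rep_term ::
    "('a list \<Rightarrow> 'a) \<Rightarrow> ('a list \<Rightarrow> 'm \<Rightarrow> 'a list \<Rightarrow> 'm) \<Rightarrow> nat \<Rightarrow> nat \<Rightarrow> 'a list \<Rightarrow> 'm \<Rightarrow> 'a list \<Rightarrow> 'm" where
  "rep_term \<mu> \<eta> i l as u bs =
    (let j = length as + 1 in
     if i + l \<le> j then \<eta> (plug i l \<mu> as) u bs
     else if i \<le> j then
       \<eta> (take (i - 1) as) (\<eta> (drop (i - 1) as) u (take (i + l - 1 - j) bs)) (drop (i + l - 1 - j) bs)
     else \<eta> as u (plug (i - j) l \<mu> bs))"

locale ainf_representation =
  ainf_algebra sA VA \<mu> + M: graded_space sM VM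
  for sA :: "'k::field_char_0 \<Rightarrow> 'a::ab_group_add \<Rightarrow> 'a" and VA \<mu>
    and sM :: "'k \<Rightarrow> 'm::ab_group_add \<Rightarrow> 'm" and VM +
  fixes \<eta> :: "'a list \<Rightarrow> 'm \<Rightarrow> 'a list \<Rightarrow> 'm"
  assumes \<eta>_linear_left: "Vector_Spaces.linear sA sM (\<lambda>a. \<eta> (as @ a # as') u bs)"
    and \<eta>_linear_mid: "Vector_Spaces.linear sM sM (\<lambda>u. \<eta> as u bs)"
    and \<eta>_linear_right: "Vector_Spaces.linear sA sM (\<lambda>b. \<eta> as u (bs @ b # bs'))"
    and \<eta>_degree:
      "homogeneous VA as ds \<Longrightarrow> u \<in> VM d \<Longrightarrow> homogeneous VA bs es \<Longrightarrow>
       \<eta> as u bs \<in> VM (sum_list (ds @ d # es) + 1)"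
    and rep_identity:
      "homogeneous VA as ds \<Longrightarrow> u \<in> VM d \<Longrightarrow> homogeneous VA bs es \<Longrightarrow>
       n = length as + 1 + length bs \<Longrightarrow>
       (\<Sum>l = 1..n. \<Sum>i = 1..n - l + 1.
          sM ((-1) powi (sum_list (take (i - 1) (ds @ d # es)))) (rep_term \<mu> \<eta> i l as u bs)) = 0"


section \<open>Planar binary trees\<close>

datatype pbtree = Bar | Graft pbtree pbtree

text \<open>\<open>size\<close> counts the trivalent vertices.\<close>

definition Y :: "nat \<Rightarrow> pbtree set" where
  "Y n = {y. size y = n}"

text \<open>\<open>prune S m y\<close> simultaneously deletes the leaves with labels in \<open>S\<close>, the leaves of \<open>y\<close> being
  labelled \<open>m, \<dots>, m + size y\<close> from left to right; \<open>None\<close> means that no leaf is left.\<close>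

fun prune :: "nat set \<Rightarrow> nat \<Rightarrow> pbtree \<Rightarrow> pbtree option" where
  "prune S m Bar = (if m \<in> S then None else Some Bar)"
| "prune S m (Graft y z) =
    (case (prune S m y, prune S (m + size y + 1) z) of
       (None, r) \<Rightarrow> r
     | (Some y', None) \<Rightarrow> Some y'
     | (Some y', Some z') \<Rightarrow> Some (Graft y' z'))"

definition delete_leaves :: "nat set \<Rightarrow> pbtree \<Rightarrow> pbtree" where
  "delete_leaves S y = the (prune S 0 y)"

text \<open>\<open>R\<^sub>0\<^sup>k\<^sup>;\<^sup>i\<^sup>,\<^sup>l\<close> and \<open>R\<^sub>i\<^sup>k\<^sup>;\<^sup>i\<^sup>,\<^sup>l\<close>; \<open>k\<close> is determined by \<open>size y = k + l - 1\<close>.\<close>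

definition tree_R0 :: "nat \<Rightarrow> nat \<Rightarrow> pbtree \<Rightarrow> pbtree" where
  "tree_R0 i l y = delete_leaves {i..<i + l - 1} y"

definition tree_Ri :: "nat \<Rightarrow> nat \<Rightarrow> pbtree \<Rightarrow> pbtree" where
  "tree_Ri i l y = delete_leaves ({..<i - 1} \<union> {i + l..size y}) y"

lemma prune_card:
  "case prune S m y of None \<Rightarrow> card ({m..m + size y} - S) = 0
   | Some t \<Rightarrow> card ({m..m + size y} - S) = size t + 1"
proof (induction y arbitrary: m)
  case Bar
  show ?case by (auto simp: insert_Diff_if)
next
  case (Graft y z)
  let ?A = "{m..m + size y} - S" and ?m = "m + size y + 1"
  let ?B = "{?m..?m + size z} - S"
  have "{m..m + size (Graft y z)} - S = ?A \<union> ?B" by auto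
  moreover have "card (?A \<union> ?B) = card ?A + card ?B"
    by (rule card_Un_disjoint) auto
  ultimately show ?case
    using Graft.IH(1)[of m] Graft.IH(2)[of ?m] by (auto split: option.splits)
qed

lemma delete_leaves_in_Y:
  assumes "card ({..size y} - S) = n + 1"
  shows "delete_leaves S y \<in> Y n"
  using prune_card[where S = S and m = 0 and y = y] assms
  by (auto simp: delete_leaves_def Y_def atMost_atLeast0 split: option.splits)

lemma tree_R0_in_Y:
  assumes "y \<in> Y (k + l - 1)" "l \<ge> 1" "1 \<le> i" "i \<le> k"
  shows "tree_R0 i l y \<in> Y k"
proof -
  have "card ({..size y} - {i..<i + l - 1}) = card {..size y} - card {i..<i + l - 1}"
    using assms by (intro card_Diff_subset) (auto simp: Y_def)
  then show ?thesis
    unfolding tree_R0_def using assms by (intro delete_leaves_in_Y) (auto simp: Y_def)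
qed

lemma tree_Ri_in_Y:
  assumes "y \<in> Y (k + l - 1)" "l \<ge> 1" "1 \<le> i" "i \<le> k"
  shows "tree_Ri i l y \<in> Y l"
proof -
  have "{..size y} - ({..<i - 1} \<union> {i + l..size y}) = {i - 1..<i + l}"
    using assms by (auto simp: Y_def)
  then show ?thesis
    unfolding tree_Ri_def using assms by (intro delete_leaves_in_Y) auto
qed


section \<open>Cochains, the bracket, and \<open>Diass\<^sub>\<infinity>\<close>-algebras\<close>

text \<open>A cochain \<open>f\<close> has components \<open>f\<^sub>k(y; a\<^sub>1,\<dots>,a\<^sub>k) = f y [a\<^sub>1,\<dots>,a\<^sub>k]\<close> for \<open>k \<ge> 1\<close> and
  \<open>y \<in> Y k\<close>; its values elsewhere are irrelevant.\<close>

type_synonym ('v, 'w) cochain = "pbtree \<Rightarrow> 'v list \<Rightarrow> 'w"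

definition CY ::
    "('k::field_char_0 \<Rightarrow> 'v::ab_group_add \<Rightarrow> 'v) \<Rightarrow> (int \<Rightarrow> 'v set) \<Rightarrow>
     ('k \<Rightarrow> 'w::ab_group_add \<Rightarrow> 'w) \<Rightarrow> (int \<Rightarrow> 'w set) \<Rightarrow> int \<Rightarrow> ('v, 'w) cochain set" where
  "CY scale V scale' W n =
     {f. \<forall>k\<ge>1. \<forall>y\<in>Y k. graded_multilinear scale V scale' W n k (f y)}"

text \<open>\<open>diamond scale V n f g\<close> has as its \<open>s\<close>-ary component the sum of all \<open>f\<^sub>k \<diamondop> g\<^sub>l\<close> with
  \<open>k + l = s + 1\<close>, where \<open>g\<close> has degree \<open>n\<close>.\<close>

definition diamond ::
    "('k::field_char_0 \<Rightarrow> 'v::ab_group_add \<Rightarrow> 'v) \<Rightarrow> (int \<Rightarrow> 'v set) \<Rightarrow> int \<Rightarrow>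
     ('v, 'v) cochain \<Rightarrow> ('v, 'v) cochain \<Rightarrow> ('v, 'v) cochain" where
  "diamond scale V n f g y xs =
     (let s = length xs in
      \<Sum>l = 1..s. \<Sum>i = 1..s - l + 1.
        f (tree_R0 i l y)
          (map (koszul_sign scale V n) (take (i - 1) xs)
           @ g (tree_Ri i l y) (take l (drop (i - 1) xs)) # drop (i - 1 + l) xs))"

text \<open>The bracket of \<open>f\<close> of degree \<open>m\<close> and \<open>g\<close> of degree \<open>n\<close>.\<close>

definition bracket ::
    "('k::field_char_0 \<Rightarrow> 'v::ab_group_add \<Rightarrow> 'v) \<Rightarrow> (int \<Rightarrow> 'v set) \<Rightarrow> int \<Rightarrow> int \<Rightarrow>
     ('v, 'v) cochain \<Rightarrow> ('v, 'v) cochain \<Rightarrow> ('v, 'v) cochain" where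
  "bracket scale V m n f g y xs =
     diamond scale V n f g y xs - scale ((-1) powi (m * n)) (diamond scale V m g f y xs)"

text \<open>\<open>\<lbrace>\<dots>\<lbrace>\<lbrace>f, g\<^sub>1\<rbrace>, g\<^sub>2\<rbrace>, \<dots>, g\<^sub>r\<rbrace>\<close> for \<open>f\<close> of degree \<open>m\<close>, each \<open>g\<^sub>j\<close> being paired with its degree.\<close>

fun nested_bracket ::
    "('k::field_char_0 \<Rightarrow> 'v::ab_group_add \<Rightarrow> 'v) \<Rightarrow> (int \<Rightarrow> 'v set) \<Rightarrow> int \<Rightarrow>
     ('v, 'v) cochain \<Rightarrow> (int \<times> ('v, 'v) cochain) list \<Rightarrow> ('v, 'v) cochain" where
  "nested_bracket scale V m f [] = f"
| "nested_bracket scale V m f ((n, g) # gs) =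
     nested_bracket scale V (m + n) (bracket scale V m n f g) gs"

locale diass_inf_algebra = graded_space scale V
  for scale :: "'k::field_char_0 \<Rightarrow> 'd::ab_group_add \<Rightarrow> 'd" and V +
  fixes \<pi> :: "('d, 'd) cochain"
  assumes \<pi>_in_CY: "\<pi> \<in> CY scale V scale V 1"
    and diass_identity:
      "n \<ge> 1 \<Longrightarrow> y \<in> Y n \<Longrightarrow> length xs = n \<Longrightarrow> homogeneous V xs ds \<Longrightarrow>
       (\<Sum>l = 1..n. \<Sum>i = 1..n - l + 1.
          scale ((-1) powi (sum_list (take (i - 1) ds)))
            (\<pi> (tree_R0 i l y) (plug i l (\<pi> (tree_Ri i l y)) xs))) = 0"

context graded_space
begin

lemma component_homogeneous:
  assumes "v \<in> V d"
  shows "component V e v = (if e = d then v else 0)"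
proof -
  let ?f = "\<lambda>e. if e = d then v else 0"
  have "(\<forall>e. ?f e \<in> V e) \<and> finite {e. ?f e \<noteq> 0} \<and> v = (\<Sum>e. ?f e)"
    using assms subspace_0[OF subspace_component] by auto
  then show ?thesis
    unfolding component_def using the1_equality[OF decomposition[of v], of ?f] by simp
qed

lemma koszul_sign_homogeneous:
  assumes "v \<in> V d"
  shows "koszul_sign scale V n v = scale ((-1) powi (n * d)) v"
proof -
  have "koszul_sign scale V n v = (\<Sum>e\<in>{d}. scale ((-1) powi (n * e)) (component V e v))"
    unfolding koszul_sign_def
    by (rule Sum_any.expand_superset) (auto simp: component_homogeneous[OF assms])
  then show ?thesis
    by (simp add: component_homogeneous[OF assms])
qed

lemma multilinear_koszul_sign:
  assumes f: "graded_multilinear scale V scale V m k f"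
    and "homogeneous V xs ds" "length ws + length xs + length zs = k"
  shows "f (ws @ map (koszul_sign scale V n) xs @ zs) =
         scale ((-1) powi (n * sum_list ds)) (f (ws @ xs @ zs))"
  using assms(2,3)
proof (induction xs ds arbitrary: ws rule: list_all2_induct)
  case Nil
  then show ?case by simp
next
  case (Cons x xs d ds)
  let ?c = "(-1) powi (n * d)" and ?z = "map (koszul_sign scale V n) xs @ zs"
  have "Vector_Spaces.linear scale scale (\<lambda>y. f (ws @ y # ?z))"
    using f Cons.prems unfolding graded_multilinear_def by simp
  then have "f (ws @ scale ?c x # ?z) = scale ?c (f (ws @ x # ?z))"
    using module_hom.scale Vector_Spaces.linear_iff_module_hom by fastforce
  also have "f (ws @ x # ?z) = scale ((-1) powi (n * sum_list ds)) (f (ws @ x # xs @ zs))"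
    using Cons.IH[of "ws @ [x]"] Cons.prems by simp
  finally show ?case
    using Cons.hyps by (simp add: koszul_sign_homogeneous distrib_left power_int_add)
qed

lemma diamond_homogeneous:
  assumes f: "f \<in> CY scale V scale V m" and "s \<ge> 1" "y \<in> Y s" "length xs = s"
    and hom: "homogeneous V xs ds"
  shows "diamond scale V n f g y xs =
     (\<Sum>l = 1..s. \<Sum>i = 1..s - l + 1.
        scale ((-1) powi (n * sum_list (take (i - 1) ds)))
          (f (tree_R0 i l y) (plug i l (g (tree_Ri i l y)) xs)))"
  unfolding diamond_def Let_def plug_def \<open>length xs = s\<close>
proof (intro sum.cong refl)
  fix l i assume "l \<in> {1..s}" "i \<in> {1..s - l + 1}"
  then have "tree_R0 i l y \<in> Y (s + 1 - l)"
    using \<open>y \<in> Y s\<close> by (intro tree_R0_in_Y) auto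
  then have "graded_multilinear scale V scale V m (s + 1 - l) (f (tree_R0 i l y))"
    using f \<open>l \<in> {1..s}\<close> by (auto simp: CY_def)
  moreover have "homogeneous V (take (i - 1) xs) (take (i - 1) ds)"
    using hom by (rule list_all2_takeI)
  ultimately show "f (tree_R0 i l y)
      (map (koszul_sign scale V n) (take (i - 1) xs)
       @ g (tree_Ri i l y) (take l (drop (i - 1) xs)) # drop (i - 1 + l) xs) =
    scale ((-1) powi (n * sum_list (take (i - 1) ds)))
      (f (tree_R0 i l y)
         (take (i - 1) xs @ g (tree_Ri i l y) (take l (drop (i - 1) xs)) # drop (i - 1 + l) xs))"
    using multilinear_koszul_sign[of m "s + 1 - l" "f (tree_R0 i l y)" "take (i - 1) xs"
        "take (i - 1) ds" "[]"] \<open>l \<in> {1..s}\<close> \<open>i \<in> {1..s - l + 1}\<close> \<open>length xs = s\<close>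
    by auto
qed

end


section \<open>Homotopy relative averaging operators\<close>

text \<open>The graded space \<open>A \<oplus> M\<close>.\<close>

definition sum_scale ::
    "('k \<Rightarrow> 'a \<Rightarrow> 'a) \<Rightarrow> ('k \<Rightarrow> 'm \<Rightarrow> 'm) \<Rightarrow> 'k \<Rightarrow> 'a \<times> 'm \<Rightarrow> 'a \<times> 'm" where
  "sum_scale sA sM c x = (sA c (fst x), sM c (snd x))"

definition sum_grading :: "(int \<Rightarrow> 'a set) \<Rightarrow> (int \<Rightarrow> 'm set) \<Rightarrow> int \<Rightarrow> ('a \<times> 'm) set" where
  "sum_grading VA VM d = VA d \<times> VM d"

text \<open>For \<open>y = y\<^sub>1 \<or> y\<^sub>2\<close> with \<open>y\<^sub>1 \<in> Y (i - 1)\<close>, the entry taken from \<open>M\<close> is the \<open>i\<close>-th one, which has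
  list index \<open>size y\<^sub>1\<close>.\<close>

fun diass_of_rep ::
    "('a::zero list \<Rightarrow> 'a) \<Rightarrow> ('a list \<Rightarrow> 'm::zero \<Rightarrow> 'a list \<Rightarrow> 'm) \<Rightarrow> ('a \<times> 'm, 'a \<times> 'm) cochain" where
  "diass_of_rep \<mu> \<eta> (Graft y\<^sub>1 y\<^sub>2) xs =
     (\<mu> (map fst xs),
      \<eta> (map fst (take (size y\<^sub>1) xs)) (snd (xs ! size y\<^sub>1)) (map fst (drop (size y\<^sub>1 + 1) xs)))"
| "diass_of_rep \<mu> \<eta> Bar xs = (0, 0)"

text \<open>The inclusion of \<open>\<aa>\<close> (extension by zero) and the projection onto it.\<close>

definition extend :: "('m, 'a) cochain \<Rightarrow> ('a \<times> 'm::zero, 'a \<times> 'm) cochain" where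
  "extend P y xs = (P y (map snd xs), 0)"

definition proj :: "('a::zero \<times> 'm::zero, 'a \<times> 'm) cochain \<Rightarrow> ('a \<times> 'm, 'a \<times> 'm) cochain" where
  "proj f y xs = (fst (f y (map (\<lambda>x. (0, snd x)) xs)), 0)"

text \<open>The \<open>L\<^sub>\<infinity>\<close>-operation \<open>l\<^sub>r(\<gamma>\<^sub>1,\<dots>,\<gamma>\<^sub>r)\<close> on \<open>\<aa>\<close>, each \<open>\<gamma>\<^sub>j\<close> being paired with its degree.\<close>

definition linf ::
    "('k::field_char_0 \<Rightarrow> 'a::ab_group_add \<Rightarrow> 'a) \<Rightarrow> (int \<Rightarrow> 'a set) \<Rightarrow> ('a list \<Rightarrow> 'a) \<Rightarrow>
     ('k \<Rightarrow> 'm::ab_group_add \<Rightarrow> 'm) \<Rightarrow> (int \<Rightarrow> 'm set) \<Rightarrow> ('a list \<Rightarrow> 'm \<Rightarrow> 'a list \<Rightarrow> 'm) \<Rightarrow>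
     (int \<times> ('a \<times> 'm, 'a \<times> 'm) cochain) list \<Rightarrow> ('a \<times> 'm, 'a \<times> 'm) cochain" where
  "linf sA VA \<mu> sM VM \<eta> gs =
     proj (nested_bracket (sum_scale sA sM) (sum_grading VA VM) 1 (diass_of_rep \<mu> \<eta>) gs)"

text \<open>The infinite sums over the number of brackets, here and in \<open>exp_bracket\<close>, are finite pointwise:
  every bracket with \<open>P\<close> raises by at least one the number of inputs from \<open>M\<close> minus the number
  of outputs in \<open>M\<close>, so on \<open>s\<close> arguments all terms with more than \<open>s\<close> brackets vanish.
  \<open>Sum_any\<close> (written \<open>\<Sum>m. _\<close>) is the sum over the support.\<close>

locale homotopy_relative_averaging_operator =
  ainf_representation sA VA \<mu> sM VM \<eta>
  for sA :: "'k::field_char_0 \<Rightarrow> 'a::ab_group_add \<Rightarrow> 'a" and VA \<mu>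
    and sM :: "'k \<Rightarrow> 'm::ab_group_add \<Rightarrow> 'm" and VM \<eta> +
  fixes P :: "('m, 'a) cochain"
  assumes P_in_CY: "P \<in> CY sM VM sA VA 0"
    and maurer_cartan:
      "n \<ge> 1 \<Longrightarrow> y \<in> Y n \<Longrightarrow> length xs = n \<Longrightarrow>
       (\<Sum>r. sum_scale sA sM (1 / fact (Suc r))
          (linf sA VA \<mu> sM VM \<eta> (replicate (Suc r) (0, extend P)) y xs)) = 0"

definition exp_bracket ::
    "('k::field_char_0 \<Rightarrow> 'v::ab_group_add \<Rightarrow> 'v) \<Rightarrow> (int \<Rightarrow> 'v set) \<Rightarrow> int \<Rightarrow>
     ('v, 'v) cochain \<Rightarrow> ('v, 'v) cochain \<Rightarrow> ('v, 'v) cochain" where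
  "exp_bracket scale V n P f y xs =
     (\<Sum>m. scale (1 / fact m) (nested_bracket scale V n f (replicate m (0, P)) y xs))"

definition twisted ::
    "('k::field_char_0 \<Rightarrow> 'a::ab_group_add \<Rightarrow> 'a) \<Rightarrow> (int \<Rightarrow> 'a set) \<Rightarrow> ('a list \<Rightarrow> 'a) \<Rightarrow>
     ('k \<Rightarrow> 'm::ab_group_add \<Rightarrow> 'm) \<Rightarrow> (int \<Rightarrow> 'm set) \<Rightarrow> ('a list \<Rightarrow> 'm \<Rightarrow> 'a list \<Rightarrow> 'm) \<Rightarrow>
     ('m, 'a) cochain \<Rightarrow> ('a \<times> 'm, 'a \<times> 'm) cochain" where
  "twisted sA VA \<mu> sM VM \<eta> P =
     exp_bracket (sum_scale sA sM) (sum_grading VA VM) 1 (extend P) (diass_of_rep \<mu> \<eta>)"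

text \<open>\<open>(e\<^sup>\<lbrace>\<^sup>-\<^sup>,\<^sup>P\<^sup>\<rbrace>\<pi>)(y; u\<^sub>1,\<dots>,u\<^sub>k)\<close> as an element of \<open>M\<close>; that its \<open>A\<close>-component vanishes is what the
  Maurer-Cartan equation says.\<close>

definition diass_of_operator ::
    "('k::field_char_0 \<Rightarrow> 'a::ab_group_add \<Rightarrow> 'a) \<Rightarrow> (int \<Rightarrow> 'a set) \<Rightarrow> ('a list \<Rightarrow> 'a) \<Rightarrow>
     ('k \<Rightarrow> 'm::ab_group_add \<Rightarrow> 'm) \<Rightarrow> (int \<Rightarrow> 'm set) \<Rightarrow> ('a list \<Rightarrow> 'm \<Rightarrow> 'a list \<Rightarrow> 'm) \<Rightarrow>
     ('m, 'a) cochain \<Rightarrow> ('m, 'm) cochain" where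
  "diass_of_operator sA VA \<mu> sM VM \<eta> P y us =
     snd (twisted sA VA \<mu> sM VM \<eta> P y (map (Pair 0) us))"

end

theory Submission
  imports Defs
begin

text \<open>Composing two insertions either nests the two blocks or places them side by side, so the
  associator of the diamond product consists of the side-by-side terms and is graded symmetric in
  its last two arguments (a graded pre-Lie identity).  Hence bracketing with the degree \<open>0\<close> cochain
  \<open>P\<close> carries the relation \<open>\<pi> \<diamondop> \<pi> = 0\<close> to its divided powers \<open>\<pi>\<^sub>m = [\<dots>[\<pi>, P], \<dots>, P] / m!\<close>:
  the sums of \<open>\<pi>\<^sub>m \<diamondop> \<pi>\<^sub>m\<^sub>'\<close> over \<open>m + m' = r\<close> vanish.  Each bracket with \<open>P\<close> raises
  the weight, so only \<open>m \<le> s\<close> matters on \<open>s\<close> arguments and \<open>D = \<Sum>\<^sub>m \<pi>\<^sub>m\<close> satisfies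
  \<open>D \<diamondop> D = 0\<close>.  The Maurer-Cartan equation says that \<open>D\<close> maps arguments from \<open>M\<close> into \<open>M\<close>, so
  this identity restricts to \<open>M\<close>.\<close>

text \<open>The bracket of a degree 1 cochain with itself is twice its diamond square, so the proof
  works with squares, and the associator formula takes the place of the Jacobi identity. The price
  is that bracketing with \<open>P\<close> is not a derivation of the diamond product. The defect
  cancels only in sums symmetric under exchanging \<open>m\<close> and \<open>m'\<close>, so the
  induction runs over whole antidiagonals, never over single products. The exponential has no
  truncation common to all arities, but a diamond product on \<open>s\<close> arguments evaluates
  both factors on at most \<open>s\<close> arguments, so one cut-off serves there. Inhomogeneous
  arguments have no degree; signs are therefore kept as the linear operators
  \<open>koszul_sign\<close>, and homogeneous elements enter only through multilinearity. On trees,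
  the argument at list position \<open>j\<close> sits in the gap between the leaves \<open>j\<close>
  and \<open>j + 1\<close>, and every compatibility becomes a comparison of sets of deleted leaves.
  The gap at the root holds the entry that \<pi> takes from M; following it under deletion turns
  \<pi> \<diamondop> \<pi> = 0 into the identities of A and M.\<close>

section \<open>Iterated deletion of leaves\<close>

lemma prune_cong:
  "(\<And>j. m \<le> j \<Longrightarrow> j \<le> m + size y \<Longrightarrow> j \<in> S \<longleftrightarrow> j \<in> T) \<Longrightarrow> prune S m y = prune T m y"
proof (induction y arbitrary: m)
  case (Graft a b)
  have "prune S m a = prune T m a" "prune S (m + size a + 1) b = prune T (m + size a + 1) b"
    using Graft.prems by (auto intro!: Graft.IH)
  then show ?case by simp
qed simp

lemma delete_leaves_cong:
  "(\<And>j. j \<le> size y \<Longrightarrow> j \<in> S \<longleftrightarrow> j \<in> T) \<Longrightarrow> delete_leaves S y = delete_leaves T y"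
  unfolding delete_leaves_def by (subst prune_cong[of 0 y S T]) auto

lemma card_Some_prune: "prune S m y = Some t \<Longrightarrow> card ({m..m + size y} - S) = size t + 1"
  using prune_card[where S = S and m = m and y = y] by simp

lemma prune_eq_None_iff: "prune S m y = None \<longleftrightarrow> {m..m + size y} \<subseteq> S"
  using prune_card[where S = S and m = m and y = y] by (cases "prune S m y") (auto simp: card_eq_0_iff dest: Diff_eq_empty_iff[THEN iffD2])

text \<open>A leaf \<open>j\<close> that survives the first deletion is relabelled by the number of survivors to its
  left.\<close>

lemma prune_prune:
  assumes "prune T m y = Some z"
    and "\<And>j. m \<le> j \<Longrightarrow> j \<le> m + size y \<Longrightarrow> j \<in> U \<longleftrightarrow> j \<in> T \<or> m' + card ({m..<j} - T) \<in> S"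
  shows "prune S m' z = prune U m y"
  using assms
proof (induction y arbitrary: m m' z)
  case Bar
  then show ?case by (auto split: if_splits)
next
  case (Graft a b)
  let ?m = "m + size a + 1"
  \<comment> \<open>All survivors of the left subtree lie to the left of a leaf of \<open>b\<close>;
    their number is the offset at which the labels of the right subtree of \<open>z\<close>
    start.\<close>
  have rank: "card ({m..<j} - T) = card ({m..m + size a} - T) + card ({?m..<j} - T)"
    if "?m \<le> j" for j
  proof -
    have "{m..<j} - T = ({m..m + size a} - T) \<union> ({?m..<j} - T)" using that by auto
    then show ?thesis by (simp add: card_Un_disjoint Int_def)
  qed
  have a_None: "prune U m a = None" if "prune T m a = None"
    using that Graft.prems(2) by (auto simp: prune_eq_None_iff)
  have b_None: "prune U ?m b = None" if "prune T ?m b = None"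
    using that Graft.prems(2) by (auto simp: prune_eq_None_iff)
  have a_Some: "prune S m' a' = prune U m a" if "prune T m a = Some a'" for a'
    using that Graft.prems(2) by (intro Graft.IH) auto
  have b_Some: "prune S (m' + card ({m..m + size a} - T)) b' = prune U ?m b"
    if "prune T ?m b = Some b'" for b'
    using that Graft.prems(2) rank by (intro Graft.IH) (auto simp: add.assoc)
  show ?case
  proof (cases "prune T m a")
    case None
    then have "{m..m + size a} - T = {}" by (auto simp: prune_eq_None_iff)
    then have "prune S m' b' = prune U ?m b" if "prune T ?m b = Some b'" for b'
      using b_Some[OF that] by (simp only: card.empty add_0_right)
    then show ?thesis using None Graft.prems(1) a_None by simp
  next
    case (Some a')
    note a' = this
    show ?thesis
    proof (cases "prune T ?m b")
      case None
      then show ?thesis using Graft.prems(1) a' a_Some[OF a'] b_None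
        by (auto split: option.splits)
    next
      case (Some b')
      then have "z = Graft a' b'" using Graft.prems(1) a' by simp
      then show ?thesis
        using a_Some[OF a'] b_Some[OF Some] card_Some_prune[OF a'] by (simp add: add.assoc)
    qed
  qed
qed

text \<open>The leaf \<open>k\<close> witnesses that the first deletion leaves a tree, so its
  \<open>the\<close> is applied to a \<open>Some\<close>.\<close>

lemma delete_leaves_delete_leaves:
  assumes "k \<le> size y" "k \<notin> T"
    and "\<And>j. j \<le> size y \<Longrightarrow> j \<in> U \<longleftrightarrow> j \<in> T \<or> card ({..<j} - T) \<in> S"
  shows "delete_leaves S (delete_leaves T y) = delete_leaves U y"
proof -
  obtain z where z: "prune T 0 y = Some z"
    using assms(1,2) prune_eq_None_iff[of T 0 y] by (cases "prune T 0 y") auto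
  have "prune S 0 z = prune U 0 y"
    using z assms(3) by (intro prune_prune) (auto simp: lessThan_atLeast0)
  then show ?thesis by (simp add: delete_leaves_def z)
qed

section \<open>Contraction and restriction along a block\<close>

text \<open>A block of arguments is given by its list positions \<open>{p..<q}\<close>, that is \<open>i = p + 1\<close> and
  \<open>l = q - p\<close> in \<open>R\<^sub>0\<^sup>k\<^sup>;\<^sup>i\<^sup>,\<^sup>l\<close> and \<open>R\<^sub>i\<^sup>k\<^sup>;\<^sup>i\<^sup>,\<^sup>l\<close>.\<close>

definition contract :: "nat \<Rightarrow> nat \<Rightarrow> pbtree \<Rightarrow> pbtree" where
  "contract p q = delete_leaves {p<..<q}"

text \<open>A block of positions \<open>{p..<q}\<close> is bounded by the leaves \<open>p\<close>
  and \<open>q\<close>, which both survive here and under \<open>contract\<close>. The upper set is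
  unbounded so that it does not mention the size of the tree; labels beyond the last leaf do no
  harm.\<close>

definition restrict :: "nat \<Rightarrow> nat \<Rightarrow> pbtree \<Rightarrow> pbtree" where
  "restrict p q = delete_leaves ({..<p} \<union> {q<..})"

lemma contract_in_Y: "p < q \<Longrightarrow> q \<le> n \<Longrightarrow> y \<in> Y n \<Longrightarrow> contract p q y \<in> Y (n - (q - p) + 1)"
  using tree_R0_in_Y[of y "n - (q - p) + 1" "q - p" "p + 1"]
  unfolding contract_def tree_R0_def
  by (auto simp: atLeastSucLessThan_greaterThanLessThan)

lemma tree_R0_eq: "p < q \<Longrightarrow> tree_R0 (p + 1) (q - p) y = contract p q y"
  unfolding contract_def tree_R0_def
  by (simp add: atLeastSucLessThan_greaterThanLessThan)

lemma tree_Ri_eq: "p < q \<Longrightarrow> tree_Ri (p + 1) (q - p) y = restrict p q y"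
  unfolding restrict_def tree_Ri_def by (rule delete_leaves_cong) auto

lemma restrict_in_Y: "p < q \<Longrightarrow> q \<le> n \<Longrightarrow> y \<in> Y n \<Longrightarrow> restrict p q y \<in> Y (q - p)"
  using tree_Ri_in_Y[of y "n - (q - p) + 1" "q - p" "p + 1"] tree_Ri_eq[of p q y]
  by auto

lemma rank_contract:
  assumes "p < q" "j \<notin> {p<..<q}"
  shows "card ({..<j} - {p<..<q}) = (if j \<le> p then j else j - (q - p - 1))"
proof (cases "j \<le> p")
  case True
  then have "{..<j} - {p<..<q} = {..<j}" by auto
  then show ?thesis using True by simp
next
  case False
  then have "card ({..<j} - {p<..<q}) = card {..<j} - card {p<..<q}"
    using assms by (intro card_Diff_subset) auto
  then show ?thesis using False assms by simp
qed

lemma rank_restrict: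
  assumes "p \<le> j" "j \<le> q"
  shows "card ({..<j} - ({..<p} \<union> {q<..})) = j - p"
proof -
  have "{..<j} - ({..<p} \<union> {q<..}) = {p..<j}" using assms by auto
  then show ?thesis by simp
qed

text \<open>\<open>U\<close> consists of the contracted leaves and the preimage of \<open>S\<close>
  under relabelling: labels up to \<open>p\<close> stay, labels from \<open>q\<close> on drop by the
  \<open>q - p - 1\<close> deleted leaves. This lemma and \<open>delete_restrict\<close> reduce the
  composition rules below to comparisons of intervals.\<close>

lemma delete_contract:
  assumes "p < q" "q \<le> size y"
    and "\<And>j. j \<le> p \<Longrightarrow> j \<in> U \<longleftrightarrow> j \<in> S"
    and "\<And>j. p < j \<Longrightarrow> j < q \<Longrightarrow> j \<in> U"
    and "\<And>j. q \<le> j \<Longrightarrow> j \<le> size y \<Longrightarrow> j \<in> U \<longleftrightarrow> j - (q - p - 1) \<in> S"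
  shows "delete_leaves S (contract p q y) = delete_leaves U y"
  unfolding contract_def
proof (rule delete_leaves_delete_leaves)
  fix j assume "j \<le> size y"
  then show "j \<in> U \<longleftrightarrow> j \<in> {p<..<q} \<or> card ({..<j} - {p<..<q}) \<in> S"
    using assms rank_contract[of p q j] by (cases "j \<in> {p<..<q}"; cases "j \<le> p") auto
qed (use assms in auto)

lemma delete_restrict:
  assumes "p \<le> q" "q \<le> size y"
    and "\<And>j. j < p \<Longrightarrow> j \<in> U"
    and "\<And>j. q < j \<Longrightarrow> j \<le> size y \<Longrightarrow> j \<in> U"
    and "\<And>j. p \<le> j \<Longrightarrow> j \<le> q \<Longrightarrow> j \<in> U \<longleftrightarrow> j - p \<in> S"
  shows "delete_leaves S (restrict p q y) = delete_leaves U y"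
  unfolding restrict_def
proof (rule delete_leaves_delete_leaves)
  fix j assume "j \<le> size y"
  then show "j \<in> U \<longleftrightarrow> j \<in> {..<p} \<union> {q<..} \<or> card ({..<j} - ({..<p} \<union> {q<..})) \<in> S"
    using assms rank_restrict[of p j q] by (cases "p \<le> j"; cases "j \<le> q") auto
qed (use assms in auto)

section \<open>Composition rules for two blocks, nested or side by side\<close>

text \<open>The outer block contains position \<open>p\<close>, where the contracted block now
  counts as one argument. Opening it up again moves the right end by
  \<open>q - p - 1\<close>.\<close>

lemma contract_contract_nested:
  assumes "p < q" "q \<le> size y" "p' \<le> p" "p < q'"
  shows "contract p' q' (contract p q y) = contract p' (q' + (q - p) - 1) y"
  unfolding contract_def[of p'] by (rule delete_contract) (use assms in auto)

lemma restrict_contract_nested: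
  assumes "p < q" "q \<le> size y" "p' \<le> p" "p < q'" "q' + (q - p) - 1 \<le> size y"
  shows "restrict p' q' (contract p q y) = contract (p - p') (q - p') (restrict p' (q' + (q - p) - 1) y)"
proof -
  let ?U = "{..<p'} \<union> {p<..<q} \<union> {q' + (q - p) - 1<..}"
  have "restrict p' q' (contract p q y) = delete_leaves ?U y"
    unfolding restrict_def by (rule delete_contract) (use assms in auto)
  moreover have "contract (p - p') (q - p') (restrict p' (q' + (q - p) - 1) y) = delete_leaves ?U y"
    unfolding contract_def by (rule delete_restrict) (use assms in auto)
  ultimately show ?thesis by simp
qed

lemma restrict_restrict:
  assumes "a \<le> b" "b \<le> s - r" "r \<le> s" "s \<le> size y"
  shows "restrict a b (restrict r s y) = restrict (r + a) (r + b) y"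
  unfolding restrict_def[of a] restrict_def[of "r + a"]
  by (rule delete_restrict) (use assms in auto)

text \<open>The result is expressed by the set of deleted leaves because that set does not remember
  which block was contracted first; the symmetry of the side-by-side terms rests on this.\<close>

lemma contract_contract_left:
  assumes "p < q" "q \<le> size y" "p' < q'" "q' \<le> p"
  shows "contract p' q' (contract p q y) = delete_leaves ({p'<..<q'} \<union> {p<..<q}) y"
  unfolding contract_def[of p'] by (rule delete_contract) (use assms in auto)

lemma contract_contract_right:
  assumes "p < q" "q \<le> size y" "p < p'" "p' < q'"
  shows "contract p' q' (contract p q y) =
    delete_leaves ({p<..<q} \<union> {p' + (q - p) - 1<..<q' + (q - p) - 1}) y"
  unfolding contract_def[of p'] by (rule delete_contract) (use assms in auto)

text \<open>Adjacent blocks share one boundary leaf, and a contraction deletes only interior leaves,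
  so no leaf of the other block is lost.\<close>

lemma restrict_contract_left:
  assumes "p < q" "q \<le> size y" "p' < q'" "q' \<le> p"
  shows "restrict p' q' (contract p q y) = restrict p' q' y"
  unfolding restrict_def by (rule delete_contract) (use assms in auto)

lemma restrict_contract_right:
  assumes "p < q" "q \<le> size y" "p < p'" "p' < q'"
  shows "restrict p' q' (contract p q y) = restrict (p' + (q - p) - 1) (q' + (q - p) - 1) y"
  unfolding restrict_def by (rule delete_contract) (use assms in auto)

section \<open>Multilinear maps and Koszul signs\<close>

lemma linear_iff_add_scale:
  "Vector_Spaces.linear s t f \<longleftrightarrow> vector_space s \<and> vector_space t \<and>
     (\<forall>x y. f (x + y) = f x + f y) \<and> (\<forall>c x. f (s c x) = t c (f x))"
  unfolding Vector_Spaces.linear_def module_hom_def module_hom_axioms_def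
  by (auto simp: module_iff_vector_space)

lemma linear_map_zero: "Vector_Spaces.linear s t f \<Longrightarrow> f 0 = 0"
  unfolding linear_iff_add_scale by (metis add_cancel_right_right)

lemma linear_map_add: "Vector_Spaces.linear s t f \<Longrightarrow> f (x + y) = f x + f y"
  by (simp add: linear_iff_add_scale)

lemma linear_map_scale: "Vector_Spaces.linear s t f \<Longrightarrow> f (s c x) = t c (f x)"
  by (simp add: linear_iff_add_scale)

lemma linear_map_neg: "Vector_Spaces.linear s t f \<Longrightarrow> f (- x) = - f x"
  using linear_map_add[of s t f x "- x"] linear_map_zero[of s t f] by (simp add: eq_neg_iff_add_eq_0 add.commute)

lemma linear_map_diff: "Vector_Spaces.linear s t f \<Longrightarrow> f (x - y) = f x - f y"
  using linear_map_add[of s t f x "- y"] linear_map_neg[of s t f y] by simp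

lemma linear_map_sum: "Vector_Spaces.linear s t f \<Longrightarrow> f (sum h I) = (\<Sum>i\<in>I. f (h i))"
  by (induction I rule: infinite_finite_induct) (simp_all add: linear_map_zero linear_map_add)

text \<open>The update form names a slot by its index alone, which is convenient when its place
  relative to a block has to be split into cases.\<close>

lemma linear_slot_iff_update:
  "(\<forall>xs zs. length xs + 1 + length zs = k \<longrightarrow> Vector_Spaces.linear s t (\<lambda>y. f (xs @ y # zs))) \<longleftrightarrow>
   (\<forall>xs j. length xs = k \<longrightarrow> j < k \<longrightarrow> Vector_Spaces.linear s t (\<lambda>y. f (xs[j := y])))"
proof (safe, goal_cases)
  case (1 xs j)
  then have "xs[j := y] = take j xs @ y # drop (Suc j) xs" for y
    by (simp add: upd_conv_take_nth_drop)
  then show ?case using 1 by simp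
next
  case (2 xs zs)
  then have "Vector_Spaces.linear s t (\<lambda>y. f ((xs @ undefined # zs)[length xs := y]))"
    by (metis length_append length_Cons add.commute add_Suc_right add_Suc less_add_Suc1 plus_1_eq_Suc)
  then show ?case by simp
qed

lemma graded_multilinear_iff_update:
  "graded_multilinear scale V scale' W n k f \<longleftrightarrow>
     (\<forall>xs j. length xs = k \<longrightarrow> j < k \<longrightarrow> Vector_Spaces.linear scale scale' (\<lambda>y. f (xs[j := y]))) \<and>
     (\<forall>xs ds. length xs = k \<longrightarrow> homogeneous V xs ds \<longrightarrow> f xs \<in> W (sum_list ds + n))"
  unfolding graded_multilinear_def linear_slot_iff_update ..

text \<open>Arbitrary entries are expanded one at a time from the right: the prefix
  \<open>xs\<close> is still unrestricted, the suffix \<open>zs\<close> already lies in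
  \<open>B\<close>. Below, \<open>B\<close> is the set of homogeneous elements, or the union of A
  and M.\<close>

lemma multilinear_eqI_aux:
  assumes span: "\<And>v. \<exists>I h. finite I \<and> (\<forall>i\<in>I. h i \<in> B) \<and> v = (\<Sum>i\<in>(I::'i set). h i)"
    and f: "\<And>xs zs. length xs + 1 + length zs = k \<Longrightarrow> Vector_Spaces.linear s t (\<lambda>y. f (xs @ y # zs))"
    and g: "\<And>xs zs. length xs + 1 + length zs = k \<Longrightarrow> Vector_Spaces.linear s t (\<lambda>y. g (xs @ y # zs))"
    and eq: "\<And>xs. length xs = k \<Longrightarrow> set xs \<subseteq> B \<Longrightarrow> f xs = g xs"
  shows "length xs + length zs = k \<Longrightarrow> set zs \<subseteq> B \<Longrightarrow> f (xs @ zs) = g (xs @ zs)"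
proof (induction xs arbitrary: zs rule: rev_induct)
  case Nil
  then show ?case using eq by simp
next
  case (snoc v xs)
  obtain I h where I: "finite I" "\<forall>i\<in>I. h i \<in> B" "v = (\<Sum>i\<in>(I::'i set). h i)"
    using span by blast
  have "f (xs @ (\<Sum>i\<in>I. h i) # zs) = (\<Sum>i\<in>I. f (xs @ h i # zs))"
    using snoc.prems by (intro linear_map_sum[OF f]) simp
  also have "\<dots> = (\<Sum>i\<in>I. g (xs @ h i # zs))"
    using I(2) snoc.prems by (intro sum.cong refl snoc.IH) auto
  also have "\<dots> = g (xs @ (\<Sum>i\<in>I. h i) # zs)"
    using snoc.prems by (intro linear_map_sum[OF g, symmetric]) simp
  finally show ?case using I(3) by simp
qed

lemma multilinear_eqI:
  assumes span: "\<And>v. \<exists>I h. finite I \<and> (\<forall>i\<in>I. h i \<in> B) \<and> v = (\<Sum>i\<in>(I::'i set). h i)"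
    and f: "graded_multilinear s V t W m k f"
    and g: "graded_multilinear s V t W n k g"
    and eq: "\<And>xs. length xs = k \<Longrightarrow> set xs \<subseteq> B \<Longrightarrow> f xs = g xs"
    and "length xs = k"
  shows "f xs = g xs"
proof -
  have "f (xs @ []) = g (xs @ [])"
    by (rule multilinear_eqI_aux[OF span _ _ eq])
      (use f g assms(5) in \<open>auto simp: graded_multilinear_def\<close>)
  then show ?thesis by simp
qed

section \<open>Homogeneous components and the sign operator\<close>

context graded_space
begin

lemma component_eqI:
  assumes "\<And>d. f d \<in> V d" "finite {d. f d \<noteq> 0}" "v = Sum_any f"
  shows "component V d v = f d"
  unfolding component_def using the1_equality[OF decomposition[of v], of f] assms by simp

lemma component_props:
  "component V d v \<in> V d" "finite {d. component V d v \<noteq> 0}" "(\<Sum>d. component V d v) = v"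
proof -
  obtain f where f: "\<And>d. f d \<in> V d" "finite {d. f d \<noteq> 0}" "v = Sum_any f"
    using decomposition[of v] by blast
  then have "component V d v = f d" for d by (rule component_eqI)
  then show "component V d v \<in> V d" "finite {d. component V d v \<noteq> 0}" "(\<Sum>d. component V d v) = v"
    using f by auto
qed

lemma component_add: "component V d (v + w) = component V d v + component V d w"
proof (rule component_eqI)
  show "component V d v + component V d w \<in> V d" for d
    by (intro subspace_add subspace_component component_props)
  show "finite {d. component V d v + component V d w \<noteq> 0}"
    by (rule finite_subset[of _ "{d. component V d v \<noteq> 0} \<union> {d. component V d w \<noteq> 0}"])
      (auto simp: component_props)
  show "v + w = (\<Sum>d. component V d v + component V d w)"
    by (subst Sum_any.distrib) (simp_all add: component_props)
qed

lemma component_scale: "component V d (scale c v) = scale c (component V d v)"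
proof (rule component_eqI)
  show "scale c (component V d v) \<in> V d" for d
    by (intro subspace_scale subspace_component component_props)
  show fin: "finite {d. scale c (component V d v) \<noteq> 0}"
    by (rule finite_subset[of _ "{d. component V d v \<noteq> 0}"]) (auto simp: component_props)
  have "(\<Sum>d. scale c (component V d v)) = (\<Sum>d\<in>{d. component V d v \<noteq> 0}. scale c (component V d v))"
    by (rule Sum_any.expand_superset) (auto simp: component_props)
  also have "\<dots> = scale c (\<Sum>d. component V d v)"
    by (simp add: scale_sum_right Sum_any.expand_set)
  finally show "scale c v = (\<Sum>d. scale c (component V d v))" by (simp add: component_props)
qed

lemma homogeneous_span:
  "\<exists>I h. finite I \<and> (\<forall>i\<in>I. h i \<in> (\<Union>d. V d)) \<and> v = (\<Sum>i\<in>(I::int set). h i)"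
  using component_props[where v = v]
  by (intro exI[of _ "{d. component V d v \<noteq> 0}"] exI[of _ "\<lambda>d. component V d v"])
    (auto simp: component_props Sum_any.expand_set[symmetric] intro: component_props(1))

lemma vector_space_scale: "vector_space scale" ..

lemma linear_koszul_sign: "Vector_Spaces.linear scale scale (koszul_sign scale V n)"
proof -
  have eq: "koszul_sign scale V n v = (\<Sum>d\<in>I. scale ((-1) powi (n * d)) (component V d v))"
    if "finite I" "{d. component V d v \<noteq> 0} \<subseteq> I" for I v
    unfolding koszul_sign_def using that by (intro Sum_any.expand_superset) auto
  have "koszul_sign scale V n (v + w) = koszul_sign scale V n v + koszul_sign scale V n w" for v w
  proof -
    \<comment> \<open>The supports of \<open>v\<close>, \<open>w\<close> and \<open>v + w\<close>
      differ, so the three sums are first taken over one finite index set.\<close>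
    let ?I = "{d. component V d v \<noteq> 0} \<union> {d. component V d w \<noteq> 0}"
    have "finite ?I" by (simp add: component_props)
    then show ?thesis
      by (subst (1 2 3) eq[of ?I]) (auto simp: component_add scale_right_distrib sum.distrib)
  qed
  moreover have "koszul_sign scale V n (scale c v) = scale c (koszul_sign scale V n v)" for c v
    by (subst (1 2) eq[of "{d. component V d v \<noteq> 0}"])
      (auto simp: component_props component_scale scale_sum_right mult.commute)
  ultimately show ?thesis by (simp add: linear_iff_add_scale vector_space_scale)
qed

lemma multilinear_eqI_homogeneous:
  assumes "graded_multilinear scale V t W m k f" "graded_multilinear scale V t W n k g"
    and eq: "\<And>xs ds. length xs = k \<Longrightarrow> homogeneous V xs ds \<Longrightarrow> f xs = g xs"
    and "length xs = k"
  shows "f xs = g xs"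
proof (rule multilinear_eqI[OF homogeneous_span assms(1,2) _ assms(4)])
  fix xs assume "length xs = k" "set xs \<subseteq> (\<Union>d. V d)"
  moreover have "\<exists>ds. homogeneous V xs ds" if "set xs \<subseteq> (\<Union>d. V d)" for xs
    using that by (induction xs) (auto intro: list_all2_Cons[THEN iffD2])
  ultimately show "f xs = g xs" using eq by blast
qed

lemma linear_eqI_homogeneous:
  assumes f: "Vector_Spaces.linear scale t f" and g: "Vector_Spaces.linear scale t g"
    and eq: "\<And>v d. v \<in> V d \<Longrightarrow> f v = g v"
  shows "f v = g v"
proof -
  obtain I h where "finite I" "\<forall>i\<in>I. h i \<in> (\<Union>d. V d)" "v = (\<Sum>i\<in>(I::int set). h i)"
    using homogeneous_span by blast
  then show ?thesis using eq by (auto simp: linear_map_sum[OF f] linear_map_sum[OF g] intro!: sum.cong)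
qed

lemma koszul_sign_in: "v \<in> V d \<Longrightarrow> koszul_sign scale V n v \<in> V d"
  by (simp add: koszul_sign_homogeneous subspace_scale subspace_component)

text \<open>On each homogeneous component both sides are multiplication by a sign, and the exponents
  add. Arguments to the left of two insertions thus see only the total degree
  \<open>m + n\<close>.\<close>

lemma koszul_sign_koszul_sign:
  "koszul_sign scale V m (koszul_sign scale V n v) = koszul_sign scale V (m + n) v"
proof (rule linear_eqI_homogeneous[where f = "\<lambda>v. koszul_sign scale V m (koszul_sign scale V n v)"])
  show "Vector_Spaces.linear scale scale (\<lambda>v. koszul_sign scale V m (koszul_sign scale V n v))"
    using linear_koszul_sign[of m] linear_koszul_sign[of n] by (simp add: linear_iff_add_scale)
  show "koszul_sign scale V m (koszul_sign scale V n v) = koszul_sign scale V (m + n) v"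
    if "v \<in> V d" for v d
    using that linear_koszul_sign[of m]
    by (simp add: koszul_sign_homogeneous linear_map_scale power_int_add distrib_left mult.commute)
qed (rule linear_koszul_sign)

text \<open>A value of \<open>f\<close> on homogeneous arguments has the sum of their degrees plus
  \<open>m\<close> as its degree; the summand \<open>m\<close> produces the scalar. It is the source
  of the sign in the associator.\<close>

lemma koszul_sign_multilinear:
  assumes f: "graded_multilinear scale V scale V m k f" and "length xs = k"
  shows "koszul_sign scale V n (f xs) = scale ((-1) powi (m * n)) (f (map (koszul_sign scale V n) xs))"
    (is "?l xs = ?r xs")
proof (rule multilinear_eqI_homogeneous[where k = k and f = ?l and g = ?r])
  note ks = linear_koszul_sign[of n, unfolded linear_iff_add_scale]
  show "graded_multilinear scale V scale V m k ?l"
    using f ks unfolding graded_multilinear_def linear_iff_add_scale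
    by (auto intro!: koszul_sign_in)
  show "graded_multilinear scale V scale V m k ?r"
    unfolding graded_multilinear_def
  proof (intro conjI allI impI)
    fix xs zs :: "'v list" assume "length xs + 1 + length zs = k"
    then have "Vector_Spaces.linear scale scale
       (\<lambda>y. f (map (koszul_sign scale V n) xs @ y # map (koszul_sign scale V n) zs))"
      using f unfolding graded_multilinear_def by simp
    then show "Vector_Spaces.linear scale scale (\<lambda>y. ?r (xs @ y # zs))"
      using ks by (simp add: linear_iff_add_scale scale_right_distrib mult.commute)
  next
    fix xs :: "'v list" and ds assume *: "length xs = k" "homogeneous V xs ds"
    then have "homogeneous V (map (koszul_sign scale V n) xs) ds"
      by (auto simp: list_all2_conv_all_nth koszul_sign_in)
    then show "?r xs \<in> V (sum_list ds + m)"
      using f * unfolding graded_multilinear_def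
      by (auto intro!: subspace_scale subspace_component)
  qed
  fix xs ds assume *: "length xs = k" "homogeneous V xs ds"
  then have "f xs \<in> V (sum_list ds + m)" using f unfolding graded_multilinear_def by blast
  then show "?l xs = ?r xs"
    using multilinear_koszul_sign[OF f *(2), of "[]" "[]" n] *
    by (simp add: koszul_sign_homogeneous power_int_add[symmetric] algebra_simps)
qed fact

end

section \<open>The diamond product as a sum over blocks\<close>

definition slice :: "nat \<Rightarrow> nat \<Rightarrow> 'v list \<Rightarrow> 'v list" where
  "slice p q xs = take (q - p) (drop p xs)"

lemma length_slice [simp]: "q \<le> length xs \<Longrightarrow> length (slice p q xs) = q - p"
  by (simp add: slice_def)

definition blocks :: "nat \<Rightarrow> (nat \<times> nat) set" where
  "blocks n = {(p, q). p < q \<and> q \<le> n}"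

lemma finite_blocks [simp]: "finite (blocks n)"
  by (rule finite_subset[of _ "{..n} \<times> {..n}"]) (auto simp: blocks_def)

lemma linear_map_comp:
  "Vector_Spaces.linear s t f \<Longrightarrow> Vector_Spaces.linear r s g \<Longrightarrow> Vector_Spaces.linear r t (\<lambda>v. f (g v))"
  by (simp add: linear_iff_add_scale)

lemma graded_multilinear_slot:
  assumes "graded_multilinear s V t W n k f" "length xs + 1 + length zs = k"
  shows "Vector_Spaces.linear s t (\<lambda>y. f (xs @ y # zs))"
  using assms unfolding graded_multilinear_def by simp

lemma graded_multilinear_degree:
  assumes "graded_multilinear s V t W n k f" "length xs = k" "homogeneous V xs ds"
  shows "f xs \<in> W (sum_list ds + n)"
  using assms unfolding graded_multilinear_def by simp

context graded_space
begin

abbreviation ks :: "int \<Rightarrow> 'v \<Rightarrow> 'v" where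
  "ks \<equiv> koszul_sign scale V"

abbreviation dia :: "int \<Rightarrow> ('v, 'v) cochain \<Rightarrow> ('v, 'v) cochain \<Rightarrow> ('v, 'v) cochain" where
  "dia \<equiv> diamond scale V"

abbreviation cochains :: "int \<Rightarrow> ('v, 'v) cochain set" where
  "cochains \<equiv> CY scale V scale V"

text \<open>The argument list of the outer map in one summand of the diamond product. With the sign
  as an operator on the prefix, the list makes sense for inhomogeneous arguments.\<close>

definition insert_block ::
    "int \<Rightarrow> ('v, 'v) cochain \<Rightarrow> pbtree \<Rightarrow> 'v list \<Rightarrow> nat \<Rightarrow> nat \<Rightarrow> 'v list" where
  "insert_block n g y xs p q =
     map (ks n) (take p xs) @ g (restrict p q y) (slice p q xs) # drop q xs"

lemma length_insert_block [simp]: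
  "p < q \<Longrightarrow> q \<le> length xs \<Longrightarrow> length (insert_block n g y xs p q) = length xs - (q - p) + 1"
  by (simp add: insert_block_def)

text \<open>Recording a block by its two ends, \<open>p = i - 1\<close> and
  \<open>q = i - 1 + l\<close>, turns the later reindexings of double sums into shifts of
  ends.\<close>

lemma diamond_blocks:
  assumes "length xs = s"
  shows "dia n f g y xs = (\<Sum>(p, q)\<in>blocks s. f (contract p q y) (insert_block n g y xs p q))"
proof -
  let ?F = "\<lambda>l i. f (tree_R0 i l y)
          (map (ks n) (take (i - 1) xs)
           @ g (tree_Ri i l y) (take l (drop (i - 1) xs)) # drop (i - 1 + l) xs)"
  have "dia n f g y xs = (\<Sum>(l, i)\<in>(SIGMA l:{1..s}. {1..s - l + 1}). ?F l i)"
    unfolding diamond_def Let_def assms by (rule sum.Sigma) auto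
  also have "\<dots> = (\<Sum>(p, q)\<in>blocks s. f (contract p q y) (insert_block n g y xs p q))"
  proof (rule sum.reindex_bij_witness[where j = "\<lambda>(l, i). (i - 1, i - 1 + l)" and i = "\<lambda>(p, q). (q - p, p + 1)"],
      goal_cases)
    case (5 a)
    obtain l i where a: "a = (l, i)" by (cases a)
    with 5 have li: "1 \<le> l" "1 \<le> i" by auto
    then show ?case
      using tree_R0_eq[of "i - 1" "i - 1 + l" y] tree_Ri_eq[of "i - 1" "i - 1 + l" y]
      by (simp add: a insert_block_def slice_def)
  qed (auto simp: blocks_def)
  finally show ?thesis .
qed

lemma cochainsD:
  "f \<in> cochains m \<Longrightarrow> k \<ge> 1 \<Longrightarrow> y \<in> Y k \<Longrightarrow> graded_multilinear scale V scale V m k (f y)"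
  by (auto simp: CY_def)

lemma linear_insert_block:
  assumes f: "f \<in> cochains m" and g: "g \<in> cochains n" and y: "y \<in> Y s" and pq: "p < q" "q \<le> s"
    and xs: "length xs = s" "j < s"
  shows "Vector_Spaces.linear scale scale (\<lambda>v. f (contract p q y) (insert_block n g y (xs[j := v]) p q))"
proof -
  have F: "graded_multilinear scale V scale V m (s - (q - p) + 1) (f (contract p q y))"
    by (rule cochainsD[OF f]) (use contract_in_Y[OF pq y] in auto)
  have G: "graded_multilinear scale V scale V n (q - p) (g (restrict p q y))"
    by (rule cochainsD[OF g]) (use restrict_in_Y[OF pq y] pq in auto)
  note F' = F[unfolded graded_multilinear_iff_update, THEN conjunct1, rule_format]
  note G' = G[unfolded graded_multilinear_iff_update, THEN conjunct1, rule_format]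
  let ?g = "g (restrict p q y) (slice p q xs)"
  \<comment> \<open>The slot lies before the block, where it passes through the sign operator,
    inside it, where it passes through \<open>g\<close>, or after it.\<close>
  consider "j < p" | "p \<le> j" "j < q" | "q \<le> j" by linarith
  then show ?thesis
  proof cases
    case 1
    let ?L = "map (ks n) (take p xs) @ ?g # drop q xs"
    have "insert_block n g y (xs[j := v]) p q = ?L[j := ks n v]" for v
      using 1 xs pq
      by (simp add: insert_block_def slice_def take_update_swap map_update list_update_append drop_update_cancel)
    moreover have "Vector_Spaces.linear scale scale (\<lambda>v. f (contract p q y) (?L[j := ks n v]))"
      by (rule linear_map_comp[OF _ linear_koszul_sign], rule F') (use 1 xs pq in auto)
    ultimately show ?thesis by simp
  next
    case 2
    have "insert_block n g y (xs[j := v]) p q =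
       map (ks n) (take p xs) @ g (restrict p q y) ((slice p q xs)[j - p := v]) # drop q xs" for v
      using 2 xs pq
      by (simp add: insert_block_def slice_def take_update_swap drop_update_swap drop_update_cancel list_update_beyond)
    moreover have "Vector_Spaces.linear scale scale (\<lambda>v. f (contract p q y)
       (map (ks n) (take p xs) @ g (restrict p q y) ((slice p q xs)[j - p := v]) # drop q xs))"
      by (rule linear_map_comp[OF graded_multilinear_slot[OF F] G']) (use 2 xs pq in auto)
    ultimately show ?thesis by simp
  next
    case 3
    let ?L = "map (ks n) (take p xs) @ ?g # drop q xs"
    \<comment> \<open>The block has shrunk to one entry, so slot \<open>j\<close> is now preceded by
      \<open>p\<close> entries, that value, and \<open>j - q\<close> further entries. The side
      condition follows from \<open>q \<le> j\<close>.\<close>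
    have "insert_block n g y (xs[j := v]) p q = ?L[p + 1 + (j - q) := v]" if "\<not> Suc (p + j - q) < p" for v
      using 3 xs pq that
      by (simp add: insert_block_def slice_def drop_update_swap list_update_append Suc_diff_le)
    moreover have "Vector_Spaces.linear scale scale (\<lambda>v. f (contract p q y) (?L[p + 1 + (j - q) := v]))"
      by (rule F') (use 3 xs pq in auto)
    ultimately show ?thesis using 3 by simp
  qed
qed

lemma sum_list_split: "p \<le> q \<Longrightarrow>
   sum_list (take p ds) + sum_list (slice p q ds) + sum_list (drop q ds) = sum_list (ds :: int list)"
proof -
  assume "p \<le> q"
  then have "ds = take p ds @ slice p q ds @ drop q ds"
    by (metis append_take_drop_id drop_drop le_add_diff_inverse2 slice_def)
  then show ?thesis by (metis sum_list.append add.assoc)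
qed

lemma degree_insert_block:
  assumes f: "f \<in> cochains m" and g: "g \<in> cochains n" and y: "y \<in> Y s" and pq: "p < q" "q \<le> s"
    and xs: "length xs = s" "homogeneous V xs ds"
  shows "f (contract p q y) (insert_block n g y xs p q) \<in> V (sum_list ds + (m + n))"
proof -
  have F: "graded_multilinear scale V scale V m (s - (q - p) + 1) (f (contract p q y))"
    by (rule cochainsD[OF f]) (use contract_in_Y[OF pq y] in auto)
  have G: "graded_multilinear scale V scale V n (q - p) (g (restrict p q y))"
    by (rule cochainsD[OF g]) (use restrict_in_Y[OF pq y] pq in auto)
  have "homogeneous V (slice p q xs) (slice p q ds)"
    using xs by (simp add: slice_def list_all2_takeI list_all2_dropI)
  then have "g (restrict p q y) (slice p q xs) \<in> V (sum_list (slice p q ds) + n)"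
    using graded_multilinear_degree[OF G] xs pq by simp
  moreover have "homogeneous V (map (ks n) (take p xs)) (take p ds)"
    using list_all2_takeI[OF xs(2), of p] by (auto simp: list_all2_conv_all_nth koszul_sign_in)
  ultimately have "homogeneous V (insert_block n g y xs p q)
      (take p ds @ (sum_list (slice p q ds) + n) # drop q ds)"
    using xs by (auto simp: insert_block_def list_all2_dropI intro!: list_all2_appendI)
  then have "f (contract p q y) (insert_block n g y xs p q) \<in>
     V (sum_list (take p ds @ (sum_list (slice p q ds) + n) # drop q ds) + m)"
    by (intro graded_multilinear_degree[OF F]) (use xs pq in auto)
  then show ?thesis using sum_list_split[of p q ds] pq by (simp add: algebra_simps)
qed

lemma linear_sum_maps:
  assumes "\<And>i. i \<in> I \<Longrightarrow> Vector_Spaces.linear scale scale (h i)"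
  shows "Vector_Spaces.linear scale scale (\<lambda>v. \<Sum>i\<in>I. h i v)"
  using assms by (simp add: linear_iff_add_scale vector_space_scale sum.distrib scale_sum_right)

lemma diamond_in_cochains:
  assumes f: "f \<in> cochains m" and g: "g \<in> cochains n"
  shows "dia n f g \<in> cochains (m + n)"
  unfolding CY_def
proof (intro CollectI allI impI ballI)
  fix k :: nat and y assume k: "k \<ge> 1" "y \<in> Y k"
  show "graded_multilinear scale V scale V (m + n) k (dia n f g y)"
    unfolding graded_multilinear_iff_update
  proof (intro conjI allI impI)
    fix xs :: "'v list" and j assume "length xs = k" "j < k"
    then show "Vector_Spaces.linear scale scale (\<lambda>v. dia n f g y (xs[j := v]))"
      using linear_insert_block[OF f g k(2)]
      by (subst diamond_blocks[of _ k]) (auto intro!: linear_sum_maps simp: blocks_def)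
  next
    fix xs :: "'v list" and ds assume "length xs = k" "homogeneous V xs ds"
    then show "dia n f g y xs \<in> V (sum_list ds + (m + n))"
      using degree_insert_block[OF f g k(2)]
      by (subst diamond_blocks[of _ k]) (auto intro!: subspace_sum subspace_component simp: blocks_def)
  qed
qed

end

section \<open>The pre-Lie identity\<close>

lemma take_slice: "a \<le> q - p \<Longrightarrow> take a (slice p q xs) = slice p (p + a) xs"
  by (simp add: slice_def min_def)

lemma drop_slice: "drop a (slice p q xs) = slice (p + a) q xs"
  by (simp add: slice_def drop_take add.commute)

lemma slice_slice: "b \<le> q - p \<Longrightarrow> slice a b (slice p q xs) = slice (p + a) (p + b) xs"
  by (simp add: slice_def drop_take min_def add.commute)

context graded_space
begin

text \<open>Arguments before \<open>p'\<close> lie to the left of both insertions and receive both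
  signs; those from \<open>p'\<close> to \<open>p\<close> receive only the inner one, which is the
  sign prefix of the inner insertion on the slice. \<open>r\<close> is the right end of the outer
  block in the original list.\<close>

lemma insert_block_nested:
  assumes "p < q" "q \<le> size y" "p' \<le> p" "p < q'" "q' + (q - p) - 1 \<le> size y" "length xs = size y"
  defines "r \<equiv> q' + (q - p) - 1"
  shows "insert_block m g (contract p q y) (insert_block n h y xs p q) p' q' =
    map (ks (m + n)) (take p' xs) @
    g (contract (p - p') (q - p') (restrict p' r y))
      (insert_block n h (restrict p' r y) (slice p' r xs) (p - p') (q - p')) # drop r xs"
proof -
  have 1: "restrict p' q' (contract p q y) = contract (p - p') (q - p') (restrict p' r y)"
    unfolding r_def by (rule restrict_contract_nested) (use assms in auto)
  have 2: "restrict (p - p') (q - p') (restrict p' r y) = restrict p q y"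
    using restrict_restrict[of "p - p'" "q - p'" r p' y] assms by simp
  have 3: "restrict (p - p') (q - p') (restrict p' (q' + q - Suc p) y) = restrict p q y"
    using 2 assms by simp
  let ?L = "insert_block n h y xs p q"
  have "take p' ?L = map (ks n) (take p' xs)"
    using assms by (simp add: insert_block_def take_map min_def)
  moreover have "drop q' ?L = drop r xs"
    using assms by (simp add: insert_block_def drop_Cons' add.commute)
  moreover have "slice p' q' ?L = insert_block n h (restrict p' r y) (slice p' r xs) (p - p') (q - p')"
    using assms
    by (simp add: insert_block_def 3 slice_slice take_slice drop_slice)
      (simp add: slice_def take_map drop_map drop_take take_Cons')
  ultimately show ?thesis
    by (subst insert_block_def) (simp add: 1 koszul_sign_koszul_sign)
qed

text \<open>The arguments of \<open>g\<close> lie to the left of the block of \<open>h\<close>,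
  which is inserted first, and so carry its sign \<open>ks n\<close>.\<close>

lemma insert_block_left:
  assumes "p < q" "q \<le> size y" "p' < q'" "q' \<le> p" "length xs = size y"
  shows "insert_block m g (contract p q y) (insert_block n h y xs p q) p' q' =
    map (ks (m + n)) (take p' xs) @ g (restrict p' q' y) (map (ks n) (slice p' q' xs)) #
    map (ks n) (slice q' p xs) @ h (restrict p q y) (slice p q xs) # drop q xs"
proof -
  let ?L = "insert_block n h y xs p q"
  have "take p' ?L = map (ks n) (take p' xs)"
    using assms by (simp add: insert_block_def take_map min_def)
  moreover have "drop q' ?L = map (ks n) (slice q' p xs) @ h (restrict p q y) (slice p q xs) # drop q xs"
    using assms by (simp add: insert_block_def slice_def drop_map drop_take)
  moreover have "slice p' q' ?L = map (ks n) (slice p' q' xs)"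
    using assms by (simp add: insert_block_def slice_def take_map drop_map drop_take min_def)
  ultimately show ?thesis
    using assms by (subst insert_block_def) (simp add: restrict_contract_left koszul_sign_koszul_sign)
qed

text \<open>Here the sign of \<open>g\<close> meets the value of \<open>h\<close> instead of its
  arguments; \<open>insert_two_swap\<close> moves it inside. \<open>c\<close> and \<open>d\<close>
  are the ends of the block of \<open>g\<close> in the original list.\<close>

lemma insert_block_right:
  assumes "p < q" "q \<le> size y" "p < p'" "p' < q'" "length xs = size y"
  defines "c \<equiv> p' + (q - p) - 1" and "d \<equiv> q' + (q - p) - 1"
  shows "insert_block m g (contract p q y) (insert_block n h y xs p q) p' q' =
    map (ks (n + m)) (take p xs) @ ks m (h (restrict p q y) (slice p q xs)) #
    map (ks m) (slice q c xs) @ g (restrict c d y) (slice c d xs) # drop d xs"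
proof -
  let ?L = "insert_block n h y xs p q"
  have "take p' ?L = map (ks n) (take p xs) @ h (restrict p q y) (slice p q xs) # slice q c xs"
    using assms by (simp add: insert_block_def slice_def take_Cons')
  moreover have "drop q' ?L = drop d xs"
    using assms by (simp add: insert_block_def drop_Cons' add.commute)
  moreover have "slice p' q' ?L = slice c d xs"
    using assms by (simp add: insert_block_def slice_def drop_Cons' add.commute)
  ultimately show ?thesis
    using assms by (subst insert_block_def)
      (simp add: restrict_contract_right koszul_sign_koszul_sign add.commute)
qed

definition block_pairs :: "nat \<Rightarrow> ((nat \<times> nat) \<times> nat \<times> nat) set" where
  "block_pairs s = {((a, b), (c, d)). a < b \<and> b \<le> c \<and> c < d \<and> d \<le> s}"

text \<open>Here \<open>g\<close> has degree \<open>m\<close> and \<open>h\<close> has degree \<open>n\<close>.  The cochain \<open>h\<close> is applied first, so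
  its sign also reaches the arguments of \<open>g\<close>.\<close>

definition insert_two ::
    "int \<Rightarrow> int \<Rightarrow> ('v, 'v) cochain \<Rightarrow> ('v, 'v) cochain \<Rightarrow> ('v, 'v) cochain \<Rightarrow> ('v, 'v) cochain" where
  "insert_two m n f g h y xs = (\<Sum>((a, b), (c, d))\<in>block_pairs (length xs).
     f (delete_leaves ({a<..<b} \<union> {c<..<d}) y)
       (map (ks (m + n)) (take a xs) @ g (restrict a b y) (map (ks n) (slice a b xs)) #
        map (ks n) (slice b c xs) @ h (restrict c d y) (slice c d xs) # drop d xs))"

text \<open>\<open>f\<close> is linear in the slot of the inserted value, so the inner sum can be
  pulled out. The inner block \<open>(a, b)\<close> is counted from the left end \<open>r\<close> of
  the outer one.\<close>

lemma diamond_diamond_right: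
  assumes f: "f \<in> cochains l" and y: "y \<in> Y s" and xs: "length xs = s"
  shows "dia (m + n) f (dia n g h) y xs =
    (\<Sum>((r, t), (a, b))\<in>(SIGMA (r, t):blocks s. blocks (t - r)).
       f (contract r t y) (map (ks (m + n)) (take r xs) @
         g (contract a b (restrict r t y))
           (insert_block n h (restrict r t y) (slice r t xs) a b) # drop t xs))"
proof -
  have "dia (m + n) f (dia n g h) y xs =
    (\<Sum>(r, t)\<in>blocks s. \<Sum>(a, b)\<in>blocks (t - r).
       f (contract r t y) (map (ks (m + n)) (take r xs) @
         g (contract a b (restrict r t y))
           (insert_block n h (restrict r t y) (slice r t xs) a b) # drop t xs))"
    unfolding diamond_blocks[OF xs]
  proof (rule sum.cong[OF refl], safe)
    fix r t assume rt: "(r, t) \<in> blocks s"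
    then have len: "length (slice r t xs) = t - r" using xs by (simp add: blocks_def)
    have "Vector_Spaces.linear scale scale
        (\<lambda>v. f (contract r t y) (map (ks (m + n)) (take r xs) @ v # drop t xs))"
      by (rule graded_multilinear_slot[OF cochainsD[OF f _ contract_in_Y]])
        (use rt y xs in \<open>auto simp: blocks_def\<close>)
    then show "f (contract r t y) (insert_block (m + n) (dia n g h) y xs r t) =
        (\<Sum>(a, b)\<in>blocks (t - r).
       f (contract r t y) (map (ks (m + n)) (take r xs) @
         g (contract a b (restrict r t y))
           (insert_block n h (restrict r t y) (slice r t xs) a b) # drop t xs))"
      unfolding insert_block_def[of "m + n"] diamond_blocks[OF len]
      by (subst linear_map_sum) (simp_all add: case_prod_beta)
  qed
  also have "\<dots> = (\<Sum>((r, t), (a, b))\<in>(SIGMA (r, t):blocks s. blocks (t - r)).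
       f (contract r t y) (map (ks (m + n)) (take r xs) @
         g (contract a b (restrict r t y))
           (insert_block n h (restrict r t y) (slice r t xs) a b) # drop t xs))"
    by (simp add: sum.Sigma case_prod_unfold)
  finally show ?thesis .
qed

text \<open>Moving the sign operator from the value of \<open>h\<close> to its arguments costs the
  sign of \<open>m * n\<close>, which linearity of \<open>f\<close> takes out. The right-hand side
  has the shape delivered by \<open>insert_block_right\<close>.\<close>

lemma insert_two_swap:
  assumes f: "f \<in> cochains l" and g: "g \<in> cochains m" and h: "h \<in> cochains n"
    and y: "y \<in> Y s" and xs: "length xs = s"
  shows "scale ((-1) powi (m * n)) (insert_two n m f h g y xs) =
    (\<Sum>((p, q), (c, d))\<in>block_pairs s.
       f (delete_leaves ({p<..<q} \<union> {c<..<d}) y)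
         (map (ks (n + m)) (take p xs) @ ks m (h (restrict p q y) (slice p q xs)) #
          map (ks m) (slice q c xs) @ g (restrict c d y) (slice c d xs) # drop d xs))"
  unfolding insert_two_def scale_sum_right xs
proof (rule sum.cong[OF refl], safe)
  fix p q c d assume "((p, q), (c, d)) \<in> block_pairs s"
  then have pq: "p < q" "q \<le> c" "c < d" "d \<le> s" by (auto simp: block_pairs_def)
  let ?t = "delete_leaves ({p<..<q} \<union> {c<..<d}) y" and ?c = "(-1) powi (m * n)"
  \<comment> \<open>Writing the deletion as two contractions gives the arity of \<open>?t\<close>,
    and with it the linearity of \<open>f ?t\<close>.\<close>
  have "?t = contract p q (contract c d y)"
    by (rule contract_contract_left[symmetric]) (use pq y in \<open>auto simp: Y_def\<close>)
  moreover have "contract p q (contract c d y) \<in> Y (s - (d - c) + 1 - (q - p) + 1)"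
    using pq y by (intro contract_in_Y) auto
  ultimately have t: "?t \<in> Y (s - (d - c) + 1 - (q - p) + 1)" by simp
  have lin: "Vector_Spaces.linear scale scale (\<lambda>v. f ?t (map (ks (n + m)) (take p xs) @ v #
          map (ks m) (slice q c xs) @ g (restrict c d y) (slice c d xs) # drop d xs))"
    by (rule graded_multilinear_slot[OF cochainsD[OF f _ t]]) (use pq xs in auto)
  have "ks m (h (restrict p q y) (slice p q xs)) =
      scale ?c (h (restrict p q y) (map (ks m) (slice p q xs)))"
    using pq y xs
      koszul_sign_multilinear[OF cochainsD[OF h _ restrict_in_Y[of p q s y]], of "slice p q xs" m]
    by (simp add: mult.commute)
  with linear_map_scale[OF lin, of ?c "h (restrict p q y) (map (ks m) (slice p q xs))"]
  show "scale ?c (f ?t (map (ks (n + m)) (take p xs) @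
       h (restrict p q y) (map (ks m) (slice p q xs)) #
          map (ks m) (slice q c xs) @ g (restrict c d y) (slice c d xs) # drop d xs)) =
    f ?t (map (ks (n + m)) (take p xs) @ ks m (h (restrict p q y) (slice p q xs)) #
          map (ks m) (slice q c xs) @ g (restrict c d y) (slice c d xs) # drop d xs)"
    by (simp add: add.commute)
qed

text \<open>The bracketed remainder changes only by the sign of \<open>m * n\<close> when
  \<open>(g, m)\<close> and \<open>(h, n)\<close> are exchanged, which is the graded pre-Lie
  identity.\<close>

lemma associator:
  assumes f: "f \<in> cochains l" and g: "g \<in> cochains m" and h: "h \<in> cochains n"
    and y: "y \<in> Y s" and xs: "length xs = s"
  shows "dia n (dia m f g) h y xs = dia (m + n) f (dia n g h) y xs +
    (insert_two m n f g h y xs + scale ((-1) powi (m * n)) (insert_two n m f h g y xs))"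
proof -
  let ?B = "\<lambda>p q p' q'. f (contract p' q' (contract p q y))
     (insert_block m g (contract p q y) (insert_block n h y xs p q) p' q')"
  let ?G = "\<lambda>((p, q), (p', q')). ?B p q p' q'"
  define T where "T = (SIGMA (p, q):blocks s. blocks (s - (q - p) + 1))"
  \<comment> \<open>After the insertion of \<open>h\<close> its value sits at position
    \<open>p\<close>. The block of \<open>g\<close> contains that position, ends before it, or
    starts after it.\<close>
  define T1 where "T1 = {((p, q), (p', q'))\<in>T. p' \<le> p \<and> p < q'}"
  define T2 where "T2 = {((p, q), (p', q'))\<in>T. q' \<le> p}"
  define T3 where "T3 = {((p, q), (p', q'))\<in>T. p < p'}"
  have size: "size y = s" using y by (simp add: Y_def)
  have fin: "finite T" unfolding T_def by auto
  then have fin': "finite T1" "finite T2" "finite T3" unfolding T1_def T2_def T3_def by (auto intro: finite_subset)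
  have T: "T = T1 \<union> (T2 \<union> T3)" by (auto simp: T1_def T2_def T3_def)
  have "dia n (dia m f g) h y xs = (\<Sum>(p, q)\<in>blocks s. \<Sum>(p', q')\<in>blocks (s - (q - p) + 1). ?B p q p' q')"
    unfolding diamond_blocks[OF xs]
  proof (rule sum.cong[OF refl], safe)
    fix p q assume "(p, q) \<in> blocks s"
    then have "length (insert_block n h y xs p q) = s - (q - p) + 1"
      using xs by (simp add: blocks_def)
    then show "dia m f g (contract p q y) (insert_block n h y xs p q) =
        (\<Sum>(p', q')\<in>blocks (s - (q - p) + 1). ?B p q p' q')"
      by (rule diamond_blocks)
  qed
  also have "\<dots> = sum ?G T"
    by (simp add: sum.Sigma case_prod_unfold T_def)
  also have "\<dots> = sum ?G T1 + (sum ?G T2 + sum ?G T3)"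
    unfolding T using fin'
    by (subst sum.union_disjoint, simp, simp, (fastforce simp: T1_def T2_def T3_def T_def blocks_def)[])
      (subst sum.union_disjoint, simp_all, fastforce simp: T1_def T2_def T3_def T_def blocks_def)
  also have "sum ?G T1 = dia (m + n) f (dia n g h) y xs"
    unfolding diamond_diamond_right[OF f y xs]
  \<comment> \<open>The outer block is stretched back to the original list, and the inner block is
    counted from its left end.\<close>
  proof (rule sum.reindex_bij_witness[where
      j = "\<lambda>((p, q), (p', q')). ((p', q' + (q - p) - 1), (p - p', q - p'))" and
      i = "\<lambda>((r, t), (a, b)). ((r + a, r + b), (r, t - (b - a) + 1))"], goal_cases)
    case (5 z)
    obtain p q p' q' where z: "z = ((p, q), (p', q'))" by (metis surj_pair)
    with 5 have "p < q" "q \<le> size y" "p' \<le> p" "p < q'" "q' + (q - p) - 1 \<le> size y"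
      by (auto simp: T1_def T_def blocks_def size)
    then show ?case
      by (simp add: z insert_block_nested contract_contract_nested xs size)
  qed (auto simp: T1_def T_def blocks_def)
  also have "sum ?G T2 = insert_two m n f g h y xs"
    unfolding insert_two_def xs
  \<comment> \<open>The block inserted second is the left one, and \<open>block_pairs\<close> lists
    the left one first.\<close>
  proof (rule sum.reindex_bij_witness[where j = prod.swap and i = prod.swap], goal_cases)
    case (5 z)
    obtain p q p' q' where z: "z = ((p, q), (p', q'))" by (metis surj_pair)
    with 5 have "p < q" "q \<le> size y" "p' < q'" "q' \<le> p"
      by (auto simp: T2_def T_def blocks_def size)
    then show ?case
      by (simp add: z insert_block_left contract_contract_left xs size)
  qed (auto simp: T2_def T_def blocks_def block_pairs_def)
  also have "sum ?G T3 = scale ((-1) powi (m * n)) (insert_two n m f h g y xs)"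
    unfolding insert_two_swap[OF f g h y xs]
  proof (rule sum.reindex_bij_witness[where
      j = "\<lambda>((p, q), (p', q')). ((p, q), (p' + (q - p) - 1, q' + (q - p) - 1))" and
      i = "\<lambda>((p, q), (c, d)). ((p, q), (c - (q - p) + 1, d - (q - p) + 1))"], goal_cases)
    case (5 z)
    obtain p q p' q' where z: "z = ((p, q), (p', q'))" by (metis surj_pair)
    with 5 have "p < q" "q \<le> size y" "p < p'" "p' < q'"
      by (auto simp: T3_def T_def blocks_def size)
    then show ?case
      by (simp add: z insert_block_right contract_contract_right xs size)
  qed (auto simp: T3_def T_def blocks_def block_pairs_def)
  finally show ?thesis .
qed

end

section \<open>The exponential of a degree zero cochain\<close>

context graded_space
begin

section \<open>Linearity and locality of the diamond product\<close>

lemma cochains_diff: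
  assumes "f \<in> cochains n" "g \<in> cochains n"
  shows "(\<lambda>y xs. f y xs - g y xs) \<in> cochains n"
  using assms unfolding CY_def graded_multilinear_def linear_iff_add_scale
  by (auto simp: scale_right_diff_distrib subspace_diff subspace_component)

lemma cochains_scale:
  assumes "f \<in> cochains n"
  shows "(\<lambda>y xs. scale c (f y xs)) \<in> cochains n"
  using assms unfolding CY_def graded_multilinear_def linear_iff_add_scale
  by (auto simp: scale_right_distrib mult.commute subspace_scale subspace_component)

lemma cochains_sum:
  assumes "\<And>i. i \<in> I \<Longrightarrow> f i \<in> cochains n"
  shows "(\<lambda>y xs. \<Sum>i\<in>I. f i y xs) \<in> cochains n"
  unfolding CY_def graded_multilinear_def
proof (intro CollectI allI impI ballI conjI)
  fix k y and xs zs :: "'v list" assume "1 \<le> k" "y \<in> Y k" "length xs + 1 + length zs = k"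
  then show "Vector_Spaces.linear scale scale (\<lambda>v. \<Sum>i\<in>I. f i y (xs @ v # zs))"
    by (intro linear_sum_maps graded_multilinear_slot[OF cochainsD[OF assms]])
next
  fix k y and xs :: "'v list" and ds assume "1 \<le> k" "y \<in> Y k" "length xs = k" "homogeneous V xs ds"
  then show "(\<Sum>i\<in>I. f i y xs) \<in> V (sum_list ds + n)"
    by (intro subspace_sum subspace_component graded_multilinear_degree[OF cochainsD[OF assms]])
qed

text \<open>Blocks and contractions of \<open>s\<close> arguments have between 1 and
  \<open>s\<close> arguments. This permits replacing an infinite sum by a truncation that depends on
  \<open>s\<close>.\<close>

lemma diamond_cong:
  assumes "y \<in> Y s" "length xs = s"
    and "\<And>k z zs. 1 \<le> k \<Longrightarrow> z \<in> Y k \<Longrightarrow> length zs = k \<Longrightarrow> k \<le> s \<Longrightarrow> f z zs = f' z zs"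
    and "\<And>k z zs. 1 \<le> k \<Longrightarrow> z \<in> Y k \<Longrightarrow> length zs = k \<Longrightarrow> k \<le> s \<Longrightarrow> g z zs = g' z zs"
  shows "dia n f g y xs = dia n f' g' y xs"
  unfolding diamond_blocks[OF assms(2)]
proof (rule sum.cong[OF refl], safe)
  fix p q assume "(p, q) \<in> blocks s"
  then have pq: "p < q" "q \<le> s" by (auto simp: blocks_def)
  have "insert_block n g y xs p q = insert_block n g' y xs p q"
    unfolding insert_block_def
    using assms(4)[OF _ restrict_in_Y[OF pq assms(1)]] pq assms(2) by simp
  moreover have "f (contract p q y) (insert_block n g' y xs p q) = f' (contract p q y) (insert_block n g' y xs p q)"
    using assms(3)[OF _ contract_in_Y[OF pq assms(1)]] pq assms(2) by simp
  ultimately show "f (contract p q y) (insert_block n g y xs p q) =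
      f' (contract p q y) (insert_block n g' y xs p q)" by simp
qed

lemma diamond_diff_left:
  "dia n (\<lambda>y xs. f y xs - f' y xs) g y xs = dia n f g y xs - dia n f' g y xs"
  by (simp add: diamond_blocks[OF refl] sum_subtractf case_prod_unfold)

lemma diamond_scale_left:
  "dia n (\<lambda>y xs. scale c (f y xs)) g y xs = scale c (dia n f g y xs)"
  by (simp add: diamond_blocks[OF refl] scale_sum_right case_prod_unfold)

lemma diamond_sum_left:
  "dia n (\<lambda>y xs. \<Sum>i\<in>I. f i y xs) g y xs = (\<Sum>i\<in>I. dia n (f i) g y xs)"
  unfolding diamond_blocks[OF refl]
  by (subst sum.swap) (simp add: case_prod_unfold)

lemma linear_block_slot:
  assumes "f \<in> cochains l" "y \<in> Y s" "length xs = s" "(p, q) \<in> blocks s"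
  shows "Vector_Spaces.linear scale scale
     (\<lambda>v. f (contract p q y) (map (ks n) (take p xs) @ v # drop q xs))"
  by (rule graded_multilinear_slot[OF cochainsD[OF assms(1) _ contract_in_Y]])
    (use assms in \<open>auto simp: blocks_def\<close>)

lemma diamond_diff_right:
  assumes "f \<in> cochains l" "y \<in> Y s" "length xs = s"
  shows "dia n f (\<lambda>y xs. g y xs - g' y xs) y xs = dia n f g y xs - dia n f g' y xs"
  unfolding diamond_blocks[OF assms(3)] insert_block_def
  by (auto simp: sum_subtractf[symmetric] linear_map_diff[OF linear_block_slot[OF assms]] intro!: sum.cong)

lemma diamond_scale_right:
  assumes "f \<in> cochains l" "y \<in> Y s" "length xs = s"
  shows "dia n f (\<lambda>y xs. scale c (g y xs)) y xs = scale c (dia n f g y xs)"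
  unfolding diamond_blocks[OF assms(3)] insert_block_def
  by (auto simp: scale_sum_right linear_map_scale[OF linear_block_slot[OF assms]] intro!: sum.cong)

lemma diamond_sum_right:
  assumes "f \<in> cochains l" "y \<in> Y s" "length xs = s"
  shows "dia n f (\<lambda>y xs. \<Sum>i\<in>I. g i y xs) y xs = (\<Sum>i\<in>I. dia n f (g i) y xs)"
  unfolding diamond_blocks[OF assms(3)] insert_block_def
  by (subst sum.swap)
    (auto simp: linear_map_sum[OF linear_block_slot[OF assms]] intro!: sum.cong)

lemma diamond_zero_left:
  assumes "y \<in> Y s" "length xs = s"
    and "\<And>k z zs. 1 \<le> k \<Longrightarrow> z \<in> Y k \<Longrightarrow> length zs = k \<Longrightarrow> k \<le> s \<Longrightarrow> f z zs = 0"
  shows "dia n f g y xs = 0"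
proof -
  have "dia n f g y xs = dia n (\<lambda>_ _. 0) g y xs"
    by (rule diamond_cong[OF assms(1,2)]) (use assms(3) in auto)
  then show ?thesis by (simp add: diamond_blocks[OF refl] case_prod_unfold)
qed

lemma diamond_zero_right:
  assumes "h \<in> cochains l" "y \<in> Y s" "length xs = s"
    and "\<And>k z zs. 1 \<le> k \<Longrightarrow> z \<in> Y k \<Longrightarrow> length zs = k \<Longrightarrow> k \<le> s \<Longrightarrow> f z zs = 0"
  shows "dia n h f y xs = 0"
proof -
  have "dia n h f y xs = dia n h (\<lambda>_ _. 0) y xs"
    by (rule diamond_cong[OF assms(2,3)]) (use assms(4) in auto)
  then show ?thesis using diamond_scale_right[OF assms(1-3), of n 0 f] by simp
qed

section \<open>Brackets with a degree zero cochain and their divided powers\<close>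

lemma bracket_degree_0:
  "bracket scale V m 0 f P y xs = dia 0 f P y xs - dia m P f y xs"
  by (simp add: bracket_def)

lemma bracket_in_cochains:
  assumes "f \<in> cochains m" "P \<in> cochains 0"
  shows "bracket scale V m 0 f P \<in> cochains m"
proof -
  have "(\<lambda>y xs. dia 0 f P y xs - dia m P f y xs) \<in> cochains m"
    using diamond_in_cochains[OF assms] diamond_in_cochains[OF assms(2,1)]
    by (intro cochains_diff) simp_all
  moreover have "(\<lambda>y xs. dia 0 f P y xs - dia m P f y xs) = bracket scale V m 0 f P"
    by (intro ext) (simp add: bracket_degree_0)
  ultimately show ?thesis by simp
qed

text \<open>The bracket with \<open>P\<close> is a derivation of the Lie bracket only; its defect as a derivation of
  the diamond product is antisymmetric in \<open>f\<close> and \<open>g\<close>.\<close>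

lemma bracket_derivation:
  assumes f: "f \<in> cochains 1" and g: "g \<in> cochains 1" and P: "P \<in> cochains 0"
    and y: "y \<in> Y s" and xs: "length xs = s"
  shows "dia 1 (bracket scale V 1 0 f P) g y xs + dia 1 f (bracket scale V 1 0 g P) y xs =
    bracket scale V 2 0 (dia 1 f g) P y xs - (insert_two 1 1 P f g y xs - insert_two 1 1 P g f y xs)"
proof -
  have "dia 1 (bracket scale V 1 0 f P) g y xs = dia 1 (dia 0 f P) g y xs - dia 1 (dia 1 P f) g y xs"
    unfolding diamond_diff_left[symmetric] by (simp add: bracket_degree_0[abs_def])
  moreover have "dia 1 f (bracket scale V 1 0 g P) y xs = dia 1 f (dia 0 g P) y xs - dia 1 f (dia 1 P g) y xs"
    unfolding diamond_diff_right[OF f y xs, symmetric] by (simp add: bracket_degree_0[abs_def])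
  ultimately show ?thesis
    using associator[OF f P g y xs] associator[OF f g P y xs] associator[OF P f g y xs]
    by (simp add: bracket_degree_0)
qed

text \<open>With \<open>1 / fact r\<close> built in, these are the coefficients of the exponential,
  and their convolutions carry no binomial coefficients.\<close>

definition ad_power :: "('v, 'v) cochain \<Rightarrow> ('v, 'v) cochain \<Rightarrow> nat \<Rightarrow> ('v, 'v) cochain" where
  "ad_power \<pi> P r y xs = scale (1 / fact r) (nested_bracket scale V 1 \<pi> (replicate r (0, P)) y xs)"

text \<open>The recursion of \<open>nested_bracket\<close> peels off the innermost bracket; the
  inductions on the number of brackets need the outermost one.\<close>

lemma nested_bracket_replicate_Suc:
  "nested_bracket scale V m f (replicate (Suc r) (0, P)) =
   bracket scale V m 0 (nested_bracket scale V m f (replicate r (0, P))) P"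
  by (induction r arbitrary: f) simp_all

lemma bracket_scale_left:
  assumes "P \<in> cochains 0" "y \<in> Y s" "length xs = s"
  shows "bracket scale V m 0 (\<lambda>y xs. scale c (f y xs)) P y xs = scale c (bracket scale V m 0 f P y xs)"
  by (simp add: bracket_degree_0 diamond_scale_left diamond_scale_right[OF assms] scale_right_diff_distrib)

lemma bracket_sum_left:
  assumes "P \<in> cochains 0" "y \<in> Y s" "length xs = s"
  shows "bracket scale V m 0 (\<lambda>y xs. \<Sum>i\<in>I. f i y xs) P y xs = (\<Sum>i\<in>I. bracket scale V m 0 (f i) P y xs)"
  by (simp add: bracket_degree_0 diamond_sum_left diamond_sum_right[OF assms] sum_subtractf)

lemma ad_power_Suc:
  assumes "P \<in> cochains 0" "y \<in> Y s" "length xs = s"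
  shows "scale (of_nat (Suc r)) (ad_power \<pi> P (Suc r) y xs) = bracket scale V 1 0 (ad_power \<pi> P r) P y xs"
proof -
  have "(of_nat (Suc r) :: 'k) * (1 / fact (Suc r)) = 1 / fact r"
    using of_nat_neq_0[of r, where ?'a = 'k] by (simp add: fact_Suc del: of_nat_Suc)
  then show ?thesis
    unfolding ad_power_def[of _ _ "Suc r"] ad_power_def[of _ _ r, abs_def]
      bracket_scale_left[OF assms] nested_bracket_replicate_Suc scale_scale by simp
qed

lemma nested_bracket_in_cochains:
  assumes "\<pi> \<in> cochains 1" "P \<in> cochains 0"
  shows "nested_bracket scale V 1 \<pi> (replicate r (0, P)) \<in> cochains 1"
proof (induction r)
  case (Suc r)
  then show ?case
    unfolding nested_bracket_replicate_Suc by (intro bracket_in_cochains assms)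
qed (simp add: assms)

lemma ad_power_in_cochains:
  assumes "\<pi> \<in> cochains 1" "P \<in> cochains 0"
  shows "ad_power \<pi> P r \<in> cochains 1"
  unfolding ad_power_def[abs_def] by (intro cochains_scale nested_bracket_in_cochains assms)

text \<open>The sum is the coefficient of degree \<open>r\<close> in the diamond square of the
  formal exponential. \<open>r + 1\<close> times the next coefficient is the bracket of this one
  with \<open>P\<close>, up to a defect that vanishes in the sum.\<close>

lemma ad_power_square:
  assumes \<pi>: "\<pi> \<in> cochains 1" and P: "P \<in> cochains 0"
    and zero: "\<And>s y xs. 1 \<le> s \<Longrightarrow> y \<in> Y s \<Longrightarrow> length xs = s \<Longrightarrow> dia 1 \<pi> \<pi> y xs = 0"
    and "1 \<le> s" "y \<in> Y s" "length xs = s"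
  shows "(\<Sum>m\<le>r. dia 1 (ad_power \<pi> P m) (ad_power \<pi> P (r - m)) y xs) = 0"
  using assms(4-)
proof (induction r arbitrary: s y xs)
  case 0
  have "ad_power \<pi> P 0 = \<pi>" by (intro ext) (simp add: ad_power_def)
  then show ?case using zero 0 by simp
next
  case (Suc r)
  note y = Suc.prems(2) and xs = Suc.prems(3)
  let ?G = "ad_power \<pi> P" and ?B = "\<lambda>m f. bracket scale V m 0 f P"
  note G = ad_power_in_cochains[OF \<pi> P]
  let ?T = "\<lambda>m. dia 1 (?G m) (?G (Suc r - m)) y xs"
  have left: "scale (of_nat (Suc m)) (?T (Suc m)) = dia 1 (?B 1 (?G m)) (?G (r - m)) y xs" for m
  proof -
    have "scale (of_nat (Suc m)) (?T (Suc m)) =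
        dia 1 (\<lambda>y xs. scale (of_nat (Suc m)) (?G (Suc m) y xs)) (?G (r - m)) y xs"
      by (simp add: diamond_scale_left)
    also have "\<dots> = dia 1 (?B 1 (?G m)) (?G (r - m)) y xs"
      by (rule diamond_cong[OF y xs]) (rule ad_power_Suc[OF P] refl; assumption)+
    finally show ?thesis .
  qed
  have right: "scale (of_nat (Suc r - m)) (?T m) = dia 1 (?G m) (?B 1 (?G (r - m))) y xs" if "m \<le> r" for m
  proof -
    have "scale (of_nat (Suc r - m)) (?T m) =
        dia 1 (?G m) (\<lambda>y xs. scale (of_nat (Suc (r - m))) (?G (Suc (r - m)) y xs)) y xs"
      using that by (simp only: diamond_scale_right[OF G y xs] Suc_diff_le)
    also have "\<dots> = dia 1 (?G m) (?B 1 (?G (r - m))) y xs"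
      by (rule diamond_cong[OF y xs]) (rule ad_power_Suc[OF P] refl; assumption)+
    finally show ?thesis .
  qed
  let ?I = "insert_two 1 1 P"
  \<comment> \<open>Exchanging \<open>m\<close> and \<open>r - m\<close> shows that the
    antisymmetric defects of \<open>bracket_derivation\<close> sum to zero.\<close>
  have swap: "(\<Sum>m\<le>r. ?I (?G m) (?G (r - m)) y xs) = (\<Sum>m\<le>r. ?I (?G (r - m)) (?G m) y xs)"
    by (rule sum.reindex_bij_witness[of _ "\<lambda>m. r - m" "\<lambda>m. r - m"]) auto
  \<comment> \<open>The bracket evaluates the previous coefficient in all arities up to
    \<open>s\<close>, so the induction hypothesis has to cover every arity.\<close>
  have E: "?B 2 (\<lambda>y xs. \<Sum>m\<le>r. dia 1 (?G m) (?G (r - m)) y xs) y xs = 0"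
    unfolding bracket_degree_0
    using diamond_zero_left[OF y xs Suc.IH] diamond_zero_right[OF P y xs Suc.IH] by simp
  \<comment> \<open>Splitting \<open>Suc r\<close> as \<open>m + (Suc r - m)\<close> supplies each
    factor with the multiple that \<open>ad_power_Suc\<close> turns into a bracket, as in the
    Leibniz rule for divided powers.\<close>
  have "scale (of_nat (Suc r)) (\<Sum>m\<le>Suc r. ?T m) =
      (\<Sum>m\<le>Suc r. scale (of_nat m) (?T m) + scale (of_nat (Suc r - m)) (?T m))"
    unfolding scale_sum_right
    by (rule sum.cong[OF refl]) (simp del: of_nat_Suc add: scale_left_distrib[symmetric] of_nat_add[symmetric])
  also have "\<dots> = (\<Sum>m\<le>Suc r. scale (of_nat m) (?T m)) + (\<Sum>m\<le>Suc r. scale (of_nat (Suc r - m)) (?T m))"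
    by (rule sum.distrib)
  also have "(\<Sum>m\<le>Suc r. scale (of_nat m) (?T m)) = (\<Sum>m\<le>r. scale (of_nat (Suc m)) (?T (Suc m)))"
    unfolding sum.atMost_Suc_shift by simp
  also have "\<dots> = (\<Sum>m\<le>r. dia 1 (?B 1 (?G m)) (?G (r - m)) y xs)"
    by (simp only: left)
  also have "(\<Sum>m\<le>Suc r. scale (of_nat (Suc r - m)) (?T m)) = (\<Sum>m\<le>r. scale (of_nat (Suc r - m)) (?T m))"
    unfolding sum.atMost_Suc by simp
  also have "\<dots> = (\<Sum>m\<le>r. dia 1 (?G m) (?B 1 (?G (r - m))) y xs)"
    by (intro sum.cong refl right) simp
  also have "(\<Sum>m\<le>r. dia 1 (?B 1 (?G m)) (?G (r - m)) y xs) +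
      (\<Sum>m\<le>r. dia 1 (?G m) (?B 1 (?G (r - m))) y xs) =
      (\<Sum>m\<le>r. ?B 2 (dia 1 (?G m) (?G (r - m))) y xs -
         (?I (?G m) (?G (r - m)) y xs - ?I (?G (r - m)) (?G m) y xs))"
    unfolding sum.distrib[symmetric] by (intro sum.cong refl bracket_derivation[OF G G P y xs])
  also have "\<dots> = 0"
    unfolding sum_subtractf swap using E unfolding bracket_sum_left[OF P y xs] by simp
  \<comment> \<open>In characteristic 0 the factor \<open>Suc r\<close> can be cancelled.\<close>
  finally show ?case using of_nat_neq_0[of r, where ?'a = 'k] by (simp del: of_nat_Suc)
qed

lemma exp_square:
  assumes \<pi>: "\<pi> \<in> cochains 1" and P: "P \<in> cochains 0"
    and zero: "\<And>s y xs. 1 \<le> s \<Longrightarrow> y \<in> Y s \<Longrightarrow> length xs = s \<Longrightarrow> dia 1 \<pi> \<pi> y xs = 0"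
    and nilpotent: "\<And>m s y xs. 1 \<le> s \<Longrightarrow> y \<in> Y s \<Longrightarrow> length xs = s \<Longrightarrow> s < m \<Longrightarrow> ad_power \<pi> P m y xs = 0"
    and D: "\<And>s y xs. 1 \<le> s \<Longrightarrow> y \<in> Y s \<Longrightarrow> length xs = s \<Longrightarrow> s \<le> N \<Longrightarrow> D y xs = (\<Sum>m\<le>N. ad_power \<pi> P m y xs)"
    and s: "1 \<le> s" "s \<le> N" and y: "y \<in> Y s" and xs: "length xs = s"
  shows "dia 1 D D y xs = 0"
proof -
  let ?G = "ad_power \<pi> P"
  let ?D = "\<lambda>y xs. \<Sum>m\<le>N. ?G m y xs"
  let ?t = "\<lambda>m m'. dia 1 (?G m) (?G m') y xs"
  note G = ad_power_in_cochains[OF \<pi> P]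
  have vanish: "?t m m' = 0" if "N < m \<or> N < m'" for m m'
    using that
  proof
    assume "N < m"
    then have "?G m z zs = 0" if "1 \<le> k" "z \<in> Y k" "length zs = k" "k \<le> s" for k z zs
      using that s nilpotent[of k z zs m] by simp
    then show ?thesis by (rule diamond_zero_left[OF y xs])
  next
    assume "N < m'"
    then have "?G m' z zs = 0" if "1 \<le> k" "z \<in> Y k" "length zs = k" "k \<le> s" for k z zs
      using that s nilpotent[of k z zs m'] by simp
    then show ?thesis by (rule diamond_zero_right[OF G y xs])
  qed
  have "dia 1 D D y xs = dia 1 ?D ?D y xs"
    by (rule diamond_cong[OF y xs]) (use D s in auto)
  also have "\<dots> = (\<Sum>m\<le>N. \<Sum>m'\<le>N. ?t m m')"
    by (simp add: diamond_sum_left diamond_sum_right[OF G y xs])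
  also have "\<dots> = (\<Sum>(m, m')\<in>{..N} \<times> {..N}. ?t m m')"
    by (rule sum.cartesian_product)
  \<comment> \<open>The triangle contains the square; each additional pair has an index above
    \<open>N\<close> and contributes zero. Unlike the square, the triangle is a union of complete
    antidiagonals.\<close>
  also have "\<dots> = (\<Sum>(m, m')\<in>{(m, m'). m + m' \<le> 2 * N}. ?t m m')"
  proof (rule sum.mono_neutral_left)
    show "finite {(m, m'). m + m' \<le> 2 * N}"
      by (rule finite_subset[of _ "{..2 * N} \<times> {..2 * N}"]) auto
  qed (auto simp: not_le intro!: vanish)
  also have "\<dots> = (\<Sum>(r, m)\<in>(SIGMA r:{..2 * N}. {..r}). ?t m (r - m))"
    by (rule sum.reindex_bij_witness[of _ "\<lambda>(r, m). (m, r - m)" "\<lambda>(m, m'). (m + m', m)"]) auto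
  also have "\<dots> = (\<Sum>r\<le>2 * N. \<Sum>m\<le>r. ?t m (r - m))"
    by (rule sum.Sigma[symmetric]) auto
  also have "\<dots> = 0"
    by (intro sum.neutral ballI ad_power_square[OF \<pi> P _ s(1) y xs] zero)
  finally show ?thesis .
qed

end

section \<open>The structure on the direct sum\<close>

lemma fst_sum_scale [simp]: "fst (sum_scale sA sM c x) = sA c (fst x)"
  by (simp add: sum_scale_def)

lemma snd_sum_scale [simp]: "snd (sum_scale sA sM c x) = sM c (snd x)"
  by (simp add: sum_scale_def)

lemma graded_space_sum:
  assumes A: "graded_space sA VA" and M: "graded_space sM VM"
  shows "graded_space (sum_scale sA sM) (sum_grading VA VM)"
proof -
  interpret A: graded_space sA VA by (rule A)
  interpret M: graded_space sM VM by (rule M)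
  interpret W: vector_space "sum_scale sA sM"
    by unfold_locales
      (simp_all add: prod_eq_iff A.scale_right_distrib A.scale_left_distrib
        M.scale_right_distrib M.scale_left_distrib)
  show ?thesis
  proof
    show "W.subspace (sum_grading VA VM d)" for d
      using A.subspace_component[of d] M.subspace_component[of d]
      unfolding W.subspace_def A.subspace_def M.subspace_def
      by (auto simp: sum_grading_def zero_prod_def sum_scale_def)
  next
    fix v :: "'b \<times> 'c"
    let ?P = "\<lambda>f. (\<forall>d. f d \<in> sum_grading VA VM d) \<and> finite {d. f d \<noteq> 0} \<and> v = Sum_any f"
    have proj: "finite {d. fst (f d) \<noteq> 0}" "finite {d. snd (f d) \<noteq> 0}"
      "fst (Sum_any f) = (\<Sum>d. fst (f d))" "snd (Sum_any f) = (\<Sum>d. snd (f d))"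
      if "finite {d. f d \<noteq> 0}" for f :: "int \<Rightarrow> 'b \<times> 'c"
    proof -
      show "finite {d. fst (f d) \<noteq> 0}" "finite {d. snd (f d) \<noteq> 0}"
        by (rule finite_subset[OF _ that], force simp: prod_eq_iff)+
      show "fst (Sum_any f) = (\<Sum>d. fst (f d))" "snd (Sum_any f) = (\<Sum>d. snd (f d))"
        unfolding Sum_any.expand_set[of f] fst_sum snd_sum
        by (rule Sum_any.expand_superset[OF that, symmetric], force simp: prod_eq_iff)+
    qed
    let ?f = "\<lambda>d. (component VA d (fst v), component VM d (snd v))"
    have fin: "finite {d. ?f d \<noteq> 0}"
      by (rule finite_subset[of _ "{d. component VA d (fst v) \<noteq> 0} \<union> {d. component VM d (snd v) \<noteq> 0}"])
        (auto simp: A.component_props M.component_props prod_eq_iff)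
    have "?P ?f"
      using fin proj(3,4)[OF fin]
      by (auto simp: A.component_props M.component_props prod_eq_iff sum_grading_def)
    moreover have "f = ?f" if "?P f" for f
    proof
      fix d
      have f: "f d \<in> sum_grading VA VM d" for d using that by blast
      have "component VA d (fst v) = fst (f d)"
        by (rule A.component_eqI) (use that f proj in \<open>auto simp: sum_grading_def mem_Times_iff\<close>)
      moreover have "component VM d (snd v) = snd (f d)"
        by (rule M.component_eqI) (use that f proj in \<open>auto simp: sum_grading_def mem_Times_iff\<close>)
      ultimately show "f d = ?f d" by (simp add: prod_eq_iff)
    qed
    ultimately show "\<exists>!f. ?P f" by (rule ex1I[where P = ?P and a = ?f])
  qed
qed

section \<open>The root gap under deletion of leaves\<close>

text \<open>A surviving leaf on each side, \<open>i\<close> and \<open>j\<close>, keeps the root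
  vertex, and the survivors on the left give the new size of the left subtree, which is the list
  position of the entry from M.\<close>

lemma delete_leaves_Graft:
  assumes "i \<le> size a" "i \<notin> S" "size a < j" "j \<le> size a + size b + 1" "j \<notin> S"
  shows "\<exists>a' b'. delete_leaves S (Graft a b) = Graft a' b' \<and> size a' + 1 = card ({..size a} - S)"
proof -
  obtain a' where a': "prune S 0 a = Some a'"
    using prune_eq_None_iff[of S 0 a] assms by (cases "prune S 0 a") auto
  have "\<not> {size a + 1..size a + 1 + size b} \<subseteq> S"
    using assms(3-5) subsetD[of "{size a + 1..size a + 1 + size b}" S j] by auto
  then obtain b' where b': "prune S (size a + 1) b = Some b'"
    using prune_eq_None_iff[of S "size a + 1" b] by (cases "prune S (size a + 1) b") auto
  show ?thesis
    using a' b' card_Some_prune[OF a'] by (simp add: delete_leaves_def atMost_atLeast0)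
qed

text \<open>The three cases are those of \<open>rep_term\<close>: the block lies before the root
  gap, contains it, or lies after it. In the middle case the root gap becomes the slot of the
  inserted value.\<close>

lemma tree_R0_Graft:
  assumes "1 \<le> i" "1 \<le> l" "i + l \<le> size a + size b + 2"
  obtains a' b' where "tree_R0 i l (Graft a b) = Graft a' b'"
    "size a' = (if i + l \<le> size a + 1 then size a - (l - 1) else if i \<le> size a + 1 then i - 1 else size a)"
proof -
  \<comment> \<open>The first and the last leaf are never interior to a block, so they serve as the
    two witnesses.\<close>
  have "\<exists>a' b'. delete_leaves {i..<i + l - 1} (Graft a b) = Graft a' b' \<and>
      size a' + 1 = card ({..size a} - {i..<i + l - 1})"
    by (rule delete_leaves_Graft[of 0 a _ "size a + size b + 1" b]) (use assms in auto)
  then obtain a' b' where ab: "tree_R0 i l (Graft a b) = Graft a' b'"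
    "size a' + 1 = card ({..size a} - {i..<i + l - 1})"
    unfolding tree_R0_def by blast
  moreover have "card ({..size a} - {i..<i + l - 1}) = size a + 1 - (l - 1)" if "i + l \<le> size a + 1"
    using that assms by (subst card_Diff_subset) auto
  moreover have "card ({..size a} - {i..<i + l - 1}) = i" if "i \<le> size a + 1" "\<not> i + l \<le> size a + 1"
  proof -
    have "{..size a} - {i..<i + l - 1} = {..<i}" using that by auto
    then show ?thesis by simp
  qed
  moreover have "card ({..size a} - {i..<i + l - 1}) = size a + 1" if "\<not> i \<le> size a + 1"
  proof -
    have "{..size a} - {i..<i + l - 1} = {..size a}" using that by auto
    then show ?thesis by simp
  qed
  ultimately show thesis using assms by (intro that[of a' b']) (auto split: if_splits)
qed

text \<open>A block around the root gap keeps the leaf \<open>i - 1\<close> on its left and the leaf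
  \<open>size a + 1\<close> on its right. The entry from M moves to its position within the
  block.\<close>

lemma tree_Ri_Graft:
  assumes "1 \<le> i" "i \<le> size a + 1" "size a + 1 < i + l"
  obtains a' b' where "tree_Ri i l (Graft a b) = Graft a' b'" "size a' = size a + 1 - i"
proof -
  let ?S = "{..<i - 1} \<union> {i + l..size (Graft a b)}"
  have "\<exists>a' b'. delete_leaves ?S (Graft a b) = Graft a' b' \<and> size a' + 1 = card ({..size a} - ?S)"
    by (rule delete_leaves_Graft[of "i - 1" a ?S "size a + 1" b]) (use assms in auto)
  then obtain a' b' where "tree_Ri i l (Graft a b) = Graft a' b'"
    "size a' + 1 = card ({..size a} - ?S)"
    unfolding tree_Ri_def by blast
  moreover have "{..size a} - ?S = {i - 1..size a}" using assms by auto
  ultimately show thesis using assms by (intro that[of a' b']) auto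
qed

lemma Y_GraftE:
  assumes "y \<in> Y k" "1 \<le> k"
  obtains a b where "y = Graft a b" "size a + size b + 1 = k"
  using assms by (cases y) (auto simp: Y_def)

context ainf_representation
begin

abbreviation "sW \<equiv> sum_scale sA sM"
abbreviation "VW \<equiv> sum_grading VA VM"

sublocale W: graded_space sW VW
  by (rule graded_space_sum) unfold_locales

lemma homogeneous_fst: "homogeneous VW xs ds \<Longrightarrow> homogeneous VA (map fst xs) ds"
  by (auto simp: list_all2_conv_all_nth sum_grading_def mem_Times_iff)

lemma diass_of_rep_linear:
  assumes "length xs + 1 + length zs = size a + size b + 1"
  shows "Vector_Spaces.linear sW sW (\<lambda>v. diass_of_rep \<mu> \<eta> (Graft a b) (xs @ v # zs))"
proof -
  have A: "Vector_Spaces.linear sA sA (\<lambda>v. \<mu> (map fst xs @ v # map fst zs))"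
    by (rule graded_multilinear_slot[OF \<mu>_multilinear]) auto
  have M: "Vector_Spaces.linear sW sM (\<lambda>v. \<eta> (map fst (take (size a) (xs @ v # zs)))
      (snd ((xs @ v # zs) ! size a)) (map fst (drop (size a + 1) (xs @ v # zs))))"
  proof -
    consider "length xs < size a" | "length xs = size a" | "size a < length xs" by linarith
    then show ?thesis
    proof cases
      case 1
      then obtain n where "size a = length xs + Suc n" by (metis less_iff_Suc_add add_Suc_right)
      then show ?thesis
        using \<eta>_linear_left[of "map fst xs" "map fst (take n zs)"]
        by (simp add: linear_iff_add_scale W.vector_space_scale nth_append)
    next
      case 2
      then show ?thesis
        using \<eta>_linear_mid[of "map fst xs" "map fst zs"]
        by (simp add: linear_iff_add_scale W.vector_space_scale nth_append)
    next
      case 3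
      then have "drop (size a + 1) (xs @ v # zs) = drop (size a + 1) xs @ v # zs" for v by simp
      then show ?thesis using 3
        using \<eta>_linear_right[of "map fst (take (size a) xs)" "snd (xs ! size a)" "map fst (drop (size a + 1) xs)" "map fst zs"]
        by (simp add: linear_iff_add_scale W.vector_space_scale nth_append)
    qed
  qed
  show ?thesis
    using A M unfolding linear_iff_add_scale
    by (simp add: prod_eq_iff W.vector_space_scale)
qed

lemma diass_of_rep_in_cochains: "diass_of_rep \<mu> \<eta> \<in> W.cochains 1"
  unfolding CY_def graded_multilinear_def
proof (intro CollectI allI impI ballI conjI)
  fix k y and xs zs :: "('a \<times> 'm) list" assume "1 \<le> k" "y \<in> Y k" "length xs + 1 + length zs = k"
  moreover from this obtain a b where "y = Graft a b" "size a + size b + 1 = k" by (elim Y_GraftE)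
  ultimately show "Vector_Spaces.linear sW sW (\<lambda>v. diass_of_rep \<mu> \<eta> y (xs @ v # zs))"
    using diass_of_rep_linear[of xs zs a b] by (simp only:)
next
  fix k y and xs :: "('a \<times> 'm) list" and ds
  assume k: "1 \<le> k" "y \<in> Y k" and xs: "length xs = k" "homogeneous VW xs ds"
  obtain a b where y: "y = Graft a b" "size a + size b + 1 = k" using k by (elim Y_GraftE)
  have "\<mu> (map fst xs) \<in> VA (sum_list ds + 1)"
    by (rule graded_multilinear_degree[OF \<mu>_multilinear[OF k(1)]]) (use xs homogeneous_fst in auto)
  moreover have ds: "take (size a) ds @ ds ! size a # drop (size a + 1) ds = ds"
    using xs y by (simp add: id_take_nth_drop[symmetric] list_all2_lengthD)
  have "\<eta> (map fst (take (size a) xs)) (snd (xs ! size a)) (map fst (drop (size a + 1) xs)) \<in>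
      VM (sum_list (take (size a) ds @ ds ! size a # drop (size a + 1) ds) + 1)"
  proof (rule \<eta>_degree)
    show "snd (xs ! size a) \<in> VM (ds ! size a)"
      using xs y by (auto simp: list_all2_conv_all_nth sum_grading_def mem_Times_iff)
  qed (use xs in \<open>auto intro!: homogeneous_fst list_all2_takeI list_all2_dropI\<close>)
  then have "\<eta> (map fst (take (size a) xs)) (snd (xs ! size a)) (map fst (drop (size a + 1) xs)) \<in>
      VM (sum_list ds + 1)"
    by (simp only: ds)
  ultimately show "diass_of_rep \<mu> \<eta> y xs \<in> VW (sum_list ds + 1)"
    by (simp add: y sum_grading_def)
qed

text \<open>If the block misses the root gap, the inserted value is read through its A-part, giving
  \<mu>; otherwise through its M-part, giving the inner \<eta>.\<close>

lemma snd_diass_of_rep_plug: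
  assumes l: "1 \<le> l" "l \<le> s" and i: "1 \<le> i" "i \<le> s - l + 1"
    and s: "s = size a + size b + 1" "length xs = s"
  shows "snd (diass_of_rep \<mu> \<eta> (tree_R0 i l (Graft a b)) (plug i l (diass_of_rep \<mu> \<eta> (tree_Ri i l (Graft a b))) xs)) =
    rep_term \<mu> \<eta> i l (map fst (take (size a) xs)) (snd (xs ! size a)) (map fst (drop (size a + 1) xs))"
proof -
  let ?g = "diass_of_rep \<mu> \<eta> (tree_Ri i l (Graft a b))"
  let ?S = "take l (drop (i - 1) xs)"
  have il: "i + l \<le> size a + size b + 2" using assms by auto
  have "Graft a b \<in> Y (s - l + 1 + l - 1)" using s l by (simp add: Y_def)
  from tree_Ri_in_Y[OF this l(1) i] obtain c d where cd: "tree_Ri i l (Graft a b) = Graft c d"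
    using l(1) by (elim Y_GraftE)
  have fst_g: "fst (?g (take l (drop (i - Suc 0) xs))) = \<mu> (map fst (take l (drop (i - Suc 0) xs)))"
    by (simp add: cd)
  obtain a' b' where R0: "tree_R0 i l (Graft a b) = Graft a' b'"
    "size a' = (if i + l \<le> size a + 1 then size a - (l - 1) else if i \<le> size a + 1 then i - 1 else size a)"
    using tree_R0_Graft[OF i(1) l(1) il] .
  define L where "L = plug i l ?g xs"
  have L: "L = take (i - 1) xs @ ?g ?S # drop (i - 1 + l) xs" by (simp add: L_def plug_def)
  have lhs: "snd (diass_of_rep \<mu> \<eta> (tree_R0 i l (Graft a b)) L) =
     \<eta> (map fst (take (size a') L)) (snd (L ! size a')) (map fst (drop (size a' + 1) L))"
    by (simp add: R0)
  consider "i + l \<le> size a + 1" | "i \<le> size a + 1" "size a + 1 < i + l" | "size a + 1 < i" by linarith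
  then show ?thesis
  proof cases
    case 1
    \<comment> \<open>\<open>n\<close> counts the arguments between the block and the entry from
      M.\<close>
    then obtain n where n: "size a + 1 = i + l + n" using le_Suc_ex by blast
    obtain i' where i': "i = Suc i'" using i by (cases i) auto
    have a': "size a' = i' + Suc n" using R0(2) 1 n l i' by simp
    have "take (size a') L = take i' xs @ ?g ?S # take n (drop (i' + l) xs)"
      using n s by (simp add: L a' i')
    moreover have "L ! size a' = xs ! size a"
      using n s l by (simp add: L a' i' nth_append; simp add: algebra_simps)
    moreover have "drop (size a' + 1) L = drop (size a + 1) xs"
      using n s by (simp add: L a' i'; simp add: algebra_simps)
    moreover have sa: "size a = i' + (l + n)" using n i' by simp
    then have "plug i l \<mu> (map fst (take (size a) xs)) =
        map fst (take i' xs) @ \<mu> (map fst ?S) # map fst (take n (drop (i' + l) xs))"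
      by (simp add: plug_def i' take_map drop_map drop_take)
    moreover have "i + l \<le> length (map fst (take (size a) xs)) + 1" using 1 s by simp
    ultimately show ?thesis
      unfolding L_def[symmetric] lhs rep_term_def Let_def by (simp add: fst_g)
  next
    case 2
    obtain c' d' where Ri: "tree_Ri i l (Graft a b) = Graft c' d'" "size c' = size a + 1 - i"
      using tree_Ri_Graft[OF i(1) 2] .
    have a': "size a' = i - 1" using R0(2) 2 by simp
    obtain i' where i': "i = Suc i'" using i by (cases i) auto
    \<comment> \<open>\<open>e\<close> and, in the next line, \<open>n\<close> count the arguments
      of the block before and after the entry from M.\<close>
    obtain e where e: "size a = i' + e" using 2 i' le_Suc_ex[of i' "size a"] by auto
    obtain n where n: "l = Suc (e + n)" using 2 i' e less_imp_Suc_add[of e l] by auto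
    have L: "take (size a') L = take i' xs" "L ! size a' = ?g ?S"
      "drop (size a' + 1) L = drop (i' + l) xs"
      using s i' e by (simp_all add: L a' nth_append)
    have "take e ?S = take e (drop i' xs)" "?S ! e = xs ! (i' + e)"
      "drop (e + 1) ?S = take n (drop (i' + e + 1) xs)"
      using s i' e n il by (simp_all add: drop_take add.commute)
    then have "snd (?g ?S) = \<eta> (map fst (take e (drop i' xs))) (snd (xs ! size a))
        (map fst (take n (drop (size a + 1) xs)))"
      using Ri e i' by simp
    then show ?thesis
      unfolding L_def[symmetric] lhs L rep_term_def Let_def using s
      by (simp add: n i' e take_map drop_map drop_take ac_simps)
  next
    case 3
    then obtain n where n: "i = size a + 2 + n" using le_Suc_ex[of "size a + 2" i] by auto
    have a': "size a' = size a" using R0(2) 3 by simp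
    have "take (size a') L = take (size a) xs" using n s by (simp add: L a' min_def)
    moreover have "L ! size a' = xs ! size a"
      using n s il by (simp add: L a' nth_append)
    moreover have "drop (size a' + 1) L = take n (drop (size a + 1) xs) @ ?g ?S # drop (i - 1 + l) xs"
      using n s il by (simp add: L a' drop_take)
    moreover have "plug (i - (size a + 1)) l \<mu> (map fst (drop (size a + 1) xs)) =
        map fst (take n (drop (size a + 1) xs)) @ \<mu> (map fst ?S) # map fst (drop (i - 1 + l) xs)"
      by (simp add: plug_def n take_map drop_map ac_simps)
    ultimately show ?thesis
      unfolding L_def[symmetric] lhs rep_term_def Let_def using 3 s
      by (simp add: fst_g)
  qed
qed

text \<open>By multilinearity homogeneous arguments suffice. The A-component is then the identity of
  A, whatever the tree; the M-component is the representation identity with the entry from M at the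
  root gap.\<close>

lemma diass_of_rep_square:
  assumes "1 \<le> s" "y \<in> Y s" "length xs = s"
  shows "W.dia 1 (diass_of_rep \<mu> \<eta>) (diass_of_rep \<mu> \<eta>) y xs = 0"
proof (rule W.multilinear_eqI_homogeneous[OF _ _ _ assms(3)])
  let ?\<pi> = "diass_of_rep \<mu> \<eta>"
  show "graded_multilinear sW VW sW VW (1 + 1) s (W.dia 1 ?\<pi> ?\<pi> y)"
    by (rule W.cochainsD[OF W.diamond_in_cochains]) (rule diass_of_rep_in_cochains assms)+
  show "graded_multilinear sW VW sW VW (1 + 1) s (\<lambda>_. 0)"
    by (simp add: graded_multilinear_def linear_iff_add_scale W.vector_space_scale W.subspace_0 W.subspace_component)
  fix xs ds assume xs: "length xs = s" "homogeneous VW xs ds"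
  obtain a b where y: "y = Graft a b" "size a + size b + 1 = s" using assms by (elim Y_GraftE)
  let ?t = "\<lambda>i l. ?\<pi> (tree_R0 i l y) (plug i l (?\<pi> (tree_Ri i l y)) xs)"
  have eq: "W.dia 1 ?\<pi> ?\<pi> y xs =
     (\<Sum>l = 1..s. \<Sum>i = 1..s - l + 1. sW ((-1) powi (1 * sum_list (take (i - 1) ds))) (?t i l))"
    by (rule W.diamond_homogeneous[OF diass_of_rep_in_cochains assms(1,2) xs])
  have t1: "fst (?t i l) = \<mu> (plug i l \<mu> (map fst xs))"
    if "l \<in> {1..s}" "i \<in> {1..s - l + 1}" for i l
  proof -
    have "y \<in> Y (s - l + 1 + l - 1)" using assms that by simp
    then have "tree_R0 i l y \<in> Y (s - l + 1)" "tree_Ri i l y \<in> Y l"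
      using tree_R0_in_Y[of y "s - l + 1" l i] tree_Ri_in_Y[of y "s - l + 1" l i] that by auto
    moreover have "1 \<le> s - l + 1" "1 \<le> l" using that by auto
    ultimately obtain c d c' d' where "tree_R0 i l y = Graft c d" "tree_Ri i l y = Graft c' d'"
      by (elim Y_GraftE)
    then show ?thesis by (simp add: plug_def take_map drop_map)
  qed
  have "fst (W.dia 1 ?\<pi> ?\<pi> y xs) = (\<Sum>l = 1..s. \<Sum>i = 1..s - l + 1.
        sA ((-1) powi (sum_list (take (i - 1) ds))) (\<mu> (plug i l \<mu> (map fst xs))))"
    unfolding eq fst_sum by (intro sum.cong refl) (simp add: t1)
  also have "\<dots> = 0"
    by (rule ainf_identity) (use assms xs homogeneous_fst in auto)
  finally have fst: "fst (W.dia 1 ?\<pi> ?\<pi> y xs) = 0" .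
  let ?as = "map fst (take (size a) xs)" and ?u = "snd (xs ! size a)" and ?bs = "map fst (drop (size a + 1) xs)"
  have ds: "take (size a) ds @ ds ! size a # drop (size a + 1) ds = ds"
    using xs y by (simp add: id_take_nth_drop[symmetric] list_all2_lengthD)
  have t2: "snd (?t i l) = rep_term \<mu> \<eta> i l ?as ?u ?bs"
    if "l \<in> {1..s}" "i \<in> {1..s - l + 1}" for i l
    unfolding y(1) using that y xs by (intro snd_diass_of_rep_plug) auto
  have "snd (W.dia 1 ?\<pi> ?\<pi> y xs) = (\<Sum>l = 1..s. \<Sum>i = 1..s - l + 1.
        sM ((-1) powi (sum_list (take (i - 1) (take (size a) ds @ ds ! size a # drop (size a + 1) ds))))
          (rep_term \<mu> \<eta> i l ?as ?u ?bs))"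
    unfolding eq snd_sum ds by (intro sum.cong refl) (simp add: t2)
  also have "\<dots> = 0"
  proof (rule rep_identity)
    show "?u \<in> VM (ds ! size a)"
      using xs y by (auto simp: list_all2_conv_all_nth sum_grading_def mem_Times_iff)
  qed (use xs y in \<open>auto intro!: homogeneous_fst list_all2_takeI list_all2_dropI\<close>)
  finally show "W.dia 1 ?\<pi> ?\<pi> y xs = 0" using fst by (simp add: prod_eq_iff)
qed

end

section \<open>Weights and the twisted structure\<close>

text \<open>\<open>True\<close> marks an entry from M and \<open>False\<close> one from A; a zero
  entry may carry either mark.\<close>

abbreviation pure :: "('a::zero \<times> 'm::zero) list \<Rightarrow> bool list \<Rightarrow> bool" where
  "pure \<equiv> list_all2 (\<lambda>x b. if b then fst x = 0 else snd x = 0)"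

abbreviation M_count :: "bool list \<Rightarrow> nat" where
  "M_count bs \<equiv> count_list bs True"

text \<open>The weight counts the inputs from \<open>M\<close> minus the outputs in \<open>M\<close>; a value in \<open>A \<oplus> M\<close> has a
  part of each kind, hence the two bounds.\<close>

definition weight_ge :: "nat \<Rightarrow> ('a::zero \<times> 'm::zero, 'a \<times> 'm) cochain \<Rightarrow> bool" where
  "weight_ge w f \<longleftrightarrow> (\<forall>k\<ge>1. \<forall>y\<in>Y k. \<forall>xs bs. length xs = k \<longrightarrow> pure xs bs \<longrightarrow>
     (M_count bs < w \<longrightarrow> fst (f y xs) = 0) \<and> (M_count bs \<le> w \<longrightarrow> snd (f y xs) = 0))"

lemma weight_geD:
  assumes "weight_ge w f" "1 \<le> k" "y \<in> Y k" "length xs = k" "pure xs bs"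
  shows "M_count bs < w \<Longrightarrow> fst (f y xs) = 0" "M_count bs \<le> w \<Longrightarrow> snd (f y xs) = 0"
  using assms unfolding weight_ge_def by blast+

lemma M_count_split:
  assumes "p < q"
  shows "M_count (take p bs) + M_count (slice p q bs) + M_count (drop q bs) = M_count bs"
proof -
  have "bs = take p bs @ slice p q bs @ drop q bs"
    by (metis append_take_drop_id assms drop_drop le_add_diff_inverse2 less_imp_le_nat slice_def)
  then show ?thesis by (metis count_list_append add.assoc)
qed

context ainf_representation
begin

text \<open>The sign operator multiplies homogeneous elements by scalars, and each of A and M is
  spanned by elements homogeneous in the sum grading.\<close>

lemma ks_pure:
  shows "fst x = 0 \<Longrightarrow> fst (W.ks n x) = 0" "snd x = 0 \<Longrightarrow> snd (W.ks n x) = 0"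
proof -
  have inl: "Vector_Spaces.linear sA sW (\<lambda>a. (a, 0))" and inr: "Vector_Spaces.linear sM sW (\<lambda>u. (0, u))"
    by (simp_all add: linear_iff_add_scale W.vector_space_scale vector_space_scale M.vector_space_scale
        sum_scale_def)
  have A: "snd (W.ks n (a, 0)) = 0" for a
  proof (rule linear_eqI_homogeneous[where f = "\<lambda>a. snd (W.ks n (a, 0))" and g = "\<lambda>_. 0"])
    show "Vector_Spaces.linear sA sM (\<lambda>a. snd (W.ks n (a, 0)))"
      using linear_map_comp[OF W.linear_koszul_sign inl, of n]
      by (simp add: linear_iff_add_scale M.vector_space_scale)
    show "Vector_Spaces.linear sA sM (\<lambda>_. 0)"
      by (simp add: linear_iff_add_scale M.vector_space_scale vector_space_scale)
    fix a d assume "a \<in> VA d"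
    then have "(a, 0) \<in> VW d"
      using M.subspace_0[OF M.subspace_component] by (simp add: sum_grading_def)
    then show "snd (W.ks n (a, 0)) = 0" by (simp add: W.koszul_sign_homogeneous)
  qed
  have M: "fst (W.ks n (0, u)) = 0" for u
  proof (rule M.linear_eqI_homogeneous[where f = "\<lambda>u. fst (W.ks n (0, u))" and g = "\<lambda>_. 0"])
    show "Vector_Spaces.linear sM sA (\<lambda>u. fst (W.ks n (0, u)))"
      using linear_map_comp[OF W.linear_koszul_sign inr, of n]
      by (simp add: linear_iff_add_scale vector_space_scale)
    show "Vector_Spaces.linear sM sA (\<lambda>_. 0)"
      by (simp add: linear_iff_add_scale M.vector_space_scale vector_space_scale)
    fix u d assume "u \<in> VM d"
    then have "(0, u) \<in> VW d"
      using subspace_0[OF subspace_component] by (simp add: sum_grading_def)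
    then show "fst (W.ks n (0, u)) = 0" by (simp add: W.koszul_sign_homogeneous)
  qed
  show "fst x = 0 \<Longrightarrow> fst (W.ks n x) = 0" using M[of "snd x"] by (cases x) simp
  show "snd x = 0 \<Longrightarrow> snd (W.ks n x) = 0" using A[of "fst x"] by (cases x) simp
qed

text \<open>The value of \<open>g\<close> is split into its two parts. A nonzero A-part has used at
  least \<open>w\<close> inputs from M and adds none to those of \<open>f\<close>; a nonzero M-part
  has used more than \<open>w\<close> and adds one. The weights add in both cases.\<close>

lemma weight_ge_block:
  assumes f: "f \<in> W.cochains m" "weight_ge v f" and g: "weight_ge w g"
    and y: "y \<in> Y s" and xs: "length xs = s" "pure xs bs" and pq: "p < q" "q \<le> s"
  shows "M_count bs < v + w \<Longrightarrow> fst (f (contract p q y) (W.insert_block n g y xs p q)) = 0"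
    and "M_count bs \<le> v + w \<Longrightarrow> snd (f (contract p q y) (W.insert_block n g y xs p q)) = 0"
proof -
  let ?z = "g (restrict p q y) (slice p q xs)" and ?c = "M_count (slice p q bs)"
  let ?h = "\<lambda>z. f (contract p q y) (map (W.ks n) (take p xs) @ z # drop q xs)"
  have lin: "Vector_Spaces.linear sW sW ?h"
    by (rule W.linear_block_slot[OF f(1) y xs(1)]) (use pq in \<open>simp add: blocks_def\<close>)
  have "?h ?z = ?h ((fst ?z, 0) + (0, snd ?z))" by simp
  also have "\<dots> = ?h (fst ?z, 0) + ?h (0, snd ?z)" by (rule linear_map_add[OF lin])
  finally have split: "f (contract p q y) (W.insert_block n g y xs p q) = ?h (fst ?z, 0) + ?h (0, snd ?z)"
    by (simp add: W.insert_block_def)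
  have "pure (slice p q xs) (slice p q bs)"
    using xs(2) by (simp add: slice_def list_all2_takeI list_all2_dropI)
  note g' = weight_geD[OF g _ restrict_in_Y[OF pq y] _ this]
  have g1: "fst ?z = 0" if "?c < w" using g'(1) that pq xs(1) by simp
  have g2: "snd ?z = 0" if "?c \<le> w" using g'(2) that pq xs(1) by simp
  have pure: "pure (map (W.ks n) (take p xs) @ z # drop q xs) (take p bs @ b # drop q bs)"
    if "if b then fst z = 0 else snd z = 0" for z b
  proof -
    have "pure (map (W.ks n) (take p xs)) (take p bs)"
      using list_all2_takeI[OF xs(2), of p]
      by (auto simp: list_all2_map1 elim!: list_all2_mono intro: ks_pure split: if_splits)
    then show ?thesis
      using that xs(2) by (intro list_all2_appendI list_all2_Cons[THEN iffD2] conjI list_all2_dropI)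
  qed
  note f' = weight_geD[OF f(2) _ contract_in_Y[OF pq y]]
  have fA: "M_count (take p bs) + M_count (drop q bs) < v \<Longrightarrow> fst (?h (z, 0)) = 0"
    "M_count (take p bs) + M_count (drop q bs) \<le> v \<Longrightarrow> snd (?h (z, 0)) = 0" for z
    using f'[OF _ _ pure[of False "(z, 0)"]] pq xs(1) by simp_all
  have fM: "M_count (take p bs) + M_count (drop q bs) + 1 < v \<Longrightarrow> fst (?h (0, z)) = 0"
    "M_count (take p bs) + M_count (drop q bs) + 1 \<le> v \<Longrightarrow> snd (?h (0, z)) = 0" for z
    using f'[OF _ _ pure[of True "(0, z)"]] pq xs(1) by simp_all
  have zero: "?h (0, 0) = 0" using linear_map_zero[OF lin] by (simp add: zero_prod_def)
  note count = M_count_split[OF pq(1), of bs]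
  show "fst (f (contract p q y) (W.insert_block n g y xs p q)) = 0" if *: "M_count bs < v + w"
  proof -
    have "fst (?h (fst ?z, 0)) = 0"
      using g1 fA(1)[of "fst ?z"] count * zero by (cases "?c < w") auto
    moreover have "fst (?h (0, snd ?z)) = 0"
      using g2 fM(1)[of "snd ?z"] count * zero by (cases "?c \<le> w") auto
    ultimately show ?thesis by (simp add: split)
  qed
  show "snd (f (contract p q y) (W.insert_block n g y xs p q)) = 0" if *: "M_count bs \<le> v + w"
  proof -
    have "snd (?h (fst ?z, 0)) = 0"
      using g1 fA(2)[of "fst ?z"] count * zero by (cases "?c < w") auto
    moreover have "snd (?h (0, snd ?z)) = 0"
      using g2 fM(2)[of "snd ?z"] count * zero by (cases "?c \<le> w") auto
    ultimately show ?thesis by (simp add: split)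
  qed
qed

lemma weight_ge_diamond:
  assumes "f \<in> W.cochains m" "weight_ge v f" "weight_ge w g"
  shows "weight_ge (v + w) (W.dia n f g)"
  unfolding weight_ge_def
proof (intro allI impI ballI)
  fix k y and xs :: "('a \<times> 'm) list" and bs
  assume y: "1 \<le> k" "y \<in> Y k" and xs: "length xs = k" "pure xs bs"
  note block = weight_ge_block[OF assms y(2) xs]
  show "(M_count bs < v + w \<longrightarrow> fst (W.dia n f g y xs) = 0) \<and>
      (M_count bs \<le> v + w \<longrightarrow> snd (W.dia n f g y xs) = 0)"
    unfolding W.diamond_blocks[OF xs(1)] fst_sum snd_sum
    by (auto simp: blocks_def intro!: sum.neutral block)
qed

lemma weight_ge_bracket:
  assumes "f \<in> W.cochains m" "weight_ge v f" "g \<in> W.cochains 0" "weight_ge w g"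
  shows "weight_ge (v + w) (bracket sW VW m 0 f g)"
  using weight_ge_diamond[OF assms(1,2,4), of 0] weight_ge_diamond[OF assms(3,4,2), of m]
  unfolding weight_ge_def by (simp add: W.bracket_degree_0 add.commute)

lemma weight_ge_ad_power:
  assumes "\<pi> \<in> W.cochains 1" "weight_ge 0 \<pi>" "P \<in> W.cochains 0" "weight_ge 1 P"
  shows "weight_ge m (W.ad_power \<pi> P m)"
proof -
  have "weight_ge m (nested_bracket sW VW 1 \<pi> (replicate m (0, P)))"
  proof (induction m)
    case (Suc m)
    then show ?case
      using weight_ge_bracket[OF W.nested_bracket_in_cochains[OF assms(1,3)] _ assms(3,4)]
      unfolding W.nested_bracket_replicate_Suc by simp
  qed (simp add: assms)
  then show ?thesis unfolding weight_ge_def W.ad_power_def by simp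
qed

text \<open>Each argument is the sum of its M-part and its A-part, indexed by the two booleans.
  Among \<open>s\<close> pure arguments at most \<open>s < m\<close> come from M, too few for a
  cochain of weight \<open>m\<close>.\<close>

lemma ad_power_eq_0:
  assumes \<pi>: "\<pi> \<in> W.cochains 1" "weight_ge 0 \<pi>" and P: "P \<in> W.cochains 0" "weight_ge 1 P"
    and s: "1 \<le> s" "s < m" and y: "y \<in> Y s" and xs: "length xs = s"
  shows "W.ad_power \<pi> P m y xs = 0"
proof (rule multilinear_eqI[where f = "W.ad_power \<pi> P m y" and g = "\<lambda>_. 0"
      and B = "{x. fst x = 0 \<or> snd x = 0}", OF _ _ _ _ xs])
  show "\<exists>I h. finite I \<and> (\<forall>i\<in>I. h i \<in> {x. fst x = 0 \<or> snd x = 0}) \<and> v = (\<Sum>i\<in>(I::bool set). h i)" for v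
    by (intro exI[of _ UNIV] exI[of _ "\<lambda>b. if b then (0, snd v) else (fst v, 0)"]) (simp add: UNIV_bool prod_eq_iff)
  show "graded_multilinear sW VW sW VW 1 s (W.ad_power \<pi> P m y)"
    by (rule W.cochainsD[OF W.ad_power_in_cochains]) fact+
  show "graded_multilinear sW VW sW VW 1 s (\<lambda>_. 0)"
    by (simp add: graded_multilinear_def linear_iff_add_scale W.vector_space_scale W.subspace_0 W.subspace_component)
next
  fix xs assume xs: "length xs = s" "set xs \<subseteq> {x. fst x = (0::'a) \<or> snd x = (0::'m)}"
  let ?bs = "map (\<lambda>x. fst x = 0) xs"
  have "pure xs ?bs" using xs(2) by (auto simp: list_all2_conv_all_nth dest: nth_mem)
  moreover have "M_count ?bs \<le> length ?bs" by (rule count_le_length)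
  ultimately show "W.ad_power \<pi> P m y xs = 0"
    using weight_geD[OF weight_ge_ad_power[OF \<pi> P, of m] s(1) y xs(1)] xs(1) s(2)
    by (simp add: prod_eq_iff)
qed

lemma zero_of_pure: "pure xs bs \<Longrightarrow> M_count bs = 0 \<Longrightarrow> map snd xs = replicate (length xs) 0"
  by (induction xs bs rule: list_all2_induct) (auto split: if_splits)

text \<open>Only the M-component needs an argument: without inputs from M the map \<eta> receives
  zero in its module slot.\<close>

lemma weight_ge_diass_of_rep: "weight_ge 0 (diass_of_rep \<mu> \<eta>)"
  unfolding weight_ge_def
proof (intro allI impI ballI conjI)
  fix k y and xs :: "('a \<times> 'm) list" and bs
  assume y: "1 \<le> k" "y \<in> Y k" and xs: "length xs = k" "pure xs bs" "M_count bs \<le> 0"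
  obtain a b where ab: "y = Graft a b" "size a + size b + 1 = k" using y by (elim Y_GraftE)
  have "snd (xs ! size a) = map snd xs ! size a" using ab xs by simp
  also have "\<dots> = 0" using zero_of_pure[OF xs(2)] ab xs by simp
  finally have "snd (xs ! size a) = 0" .
  then show "snd (diass_of_rep \<mu> \<eta> y xs) = 0"
    using linear_map_zero[OF \<eta>_linear_mid] by (simp add: ab)
qed simp

lemma multilinear_zeros:
  assumes "graded_multilinear s V t W n k f" "1 \<le> k"
  shows "f (replicate k 0) = 0"
proof -
  obtain k' where k: "k = Suc k'" using assms(2) by (cases k) auto
  show ?thesis
    using linear_map_zero[OF graded_multilinear_slot[OF assms(1), of "[]" "replicate k' 0"]] by (simp add: k)
qed

lemma extend_in_cochains:
  assumes "P \<in> CY sM VM sA VA 0"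
  shows "extend P \<in> W.cochains 0"
  unfolding CY_def graded_multilinear_def
proof (intro CollectI allI impI ballI conjI)
  fix k y and xs zs :: "('a \<times> 'm) list" assume k: "1 \<le> k" "y \<in> Y k" "length xs + 1 + length zs = k"
  then have "graded_multilinear sM VM sA VA 0 k (P y)" using assms by (auto simp: CY_def)
  from graded_multilinear_slot[OF this, of "map snd xs" "map snd zs"] k(3)
  show "Vector_Spaces.linear sW sW (\<lambda>v. extend P y (xs @ v # zs))"
    by (simp add: linear_iff_add_scale W.vector_space_scale extend_def prod_eq_iff)
next
  fix k y and xs :: "('a \<times> 'm) list" and ds
  assume k: "1 \<le> k" "y \<in> Y k" "length xs = k" "homogeneous VW xs ds"
  then have "graded_multilinear sM VM sA VA 0 k (P y)" using assms by (auto simp: CY_def)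
  moreover have "homogeneous VM (map snd xs) ds"
    using k(4) by (auto simp: list_all2_conv_all_nth sum_grading_def mem_Times_iff)
  ultimately have "P y (map snd xs) \<in> VA (sum_list ds + 0)"
    using k(3) by (intro graded_multilinear_degree) auto
  then show "extend P y xs \<in> VW (sum_list ds + 0)"
    using M.subspace_0[OF M.subspace_component] by (simp add: extend_def sum_grading_def)
qed

lemma weight_ge_extend:
  assumes "P \<in> CY sM VM sA VA 0"
  shows "weight_ge 1 (extend P)"
  unfolding weight_ge_def
proof (intro allI impI ballI conjI)
  fix k y and xs :: "('a \<times> 'm) list" and bs
  assume y: "1 \<le> k" "y \<in> Y k" and xs: "length xs = k" "pure xs bs" "M_count bs < 1"
  have "graded_multilinear sM VM sA VA 0 k (P y)" using assms y by (auto simp: CY_def)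
  then show "fst (extend P y xs) = 0"
    using zero_of_pure[OF xs(2)] multilinear_zeros[of sM VM sA VA 0 k "P y"] y xs
    by (simp add: extend_def)
qed (simp add: extend_def)

end

section \<open>The twisted structure and its restriction to M\<close>

context homotopy_relative_averaging_operator
begin

abbreviation "G \<equiv> W.ad_power (diass_of_rep \<mu> \<eta>) (extend P)"
abbreviation "D \<equiv> twisted sA VA \<mu> sM VM \<eta> P"

lemma G_eq_0: "1 \<le> s \<Longrightarrow> y \<in> Y s \<Longrightarrow> length xs = s \<Longrightarrow> s < m \<Longrightarrow> G m y xs = 0"
  using ad_power_eq_0[OF diass_of_rep_in_cochains weight_ge_diass_of_rep
      extend_in_cochains[OF P_in_CY] weight_ge_extend[OF P_in_CY]] by blast

text \<open>\<open>N\<close> stays free above \<open>s\<close>: a diamond product on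
  \<open>s\<close> arguments needs one bound for all smaller arities, and the comparison with the
  Maurer-Cartan sum needs \<open>Suc s\<close>.\<close>

lemma twisted_eq_sum:
  assumes "1 \<le> s" "y \<in> Y s" "length xs = s" "s \<le> N"
  shows "D y xs = (\<Sum>m\<le>N. G m y xs)"
  unfolding twisted_def exp_bracket_def W.ad_power_def[symmetric]
  by (rule Sum_any.expand_superset) (use G_eq_0[OF assms(1-3)] assms(4) in \<open>force simp: not_le[symmetric]\<close>)+

text \<open>The Maurer-Cartan sum starts with one bracket, the exponential with none. The missing
  term is \<pi> itself, whose A-component on arguments from M is \<mu> evaluated at zeros.\<close>

lemma fst_twisted:
  assumes "1 \<le> s" "y \<in> Y s" "length us = s"
  shows "fst (D y (map (Pair 0) us)) = 0"
proof -
  let ?xs = "map (Pair (0 :: 'a)) us"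
  have len: "length ?xs = s" using assms by simp
  have summand: "sum_scale sA sM (1 / fact (Suc r))
      (linf sA VA \<mu> sM VM \<eta> (replicate (Suc r) (0, extend P)) y ?xs) = (fst (G (Suc r) y ?xs), 0)" for r
    by (simp only: linf_def proj_def W.ad_power_def fst_sum_scale map_map comp_def snd_conv)
      (simp add: sum_scale_def M.scale_zero_right)
  have vanish: "(fst (G (Suc r) y ?xs), 0 :: 'm) = 0" if "s < r" for r
    using G_eq_0[OF assms(1,2) len, of "Suc r"] that by (simp add: zero_prod_def)
  have "(\<Sum>r\<le>s. (fst (G (Suc r) y ?xs), 0 :: 'm)) = (\<Sum>r. (fst (G (Suc r) y ?xs), 0))"
    by (rule Sum_any.expand_superset[symmetric]) (simp, rule subsetI, rule ccontr, use vanish in auto)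
  also have "\<dots> = 0"
    using maurer_cartan[OF assms(1,2) len] by (simp only: summand)
  finally have "fst (\<Sum>r\<le>s. (fst (G (Suc r) y ?xs), 0 :: 'm)) = 0" by simp
  then have tail: "(\<Sum>r\<le>s. fst (G (Suc r) y ?xs)) = 0" by (simp add: fst_sum)
  obtain a b where y: "y = Graft a b" using assms by (elim Y_GraftE)
  have "map fst ?xs = replicate s 0" using assms by (simp add: comp_def map_replicate_const)
  then have head: "fst (G 0 y ?xs) = 0"
    using multilinear_zeros[OF \<mu>_multilinear[OF assms(1)] assms(1)]
    by (simp add: W.ad_power_def y)
  have "fst (D y ?xs) = (\<Sum>m\<le>Suc s. fst (G m y ?xs))"
    by (subst twisted_eq_sum[OF assms(1,2) len, of "Suc s"]) (simp_all add: fst_sum)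
  also have "\<dots> = 0" unfolding sum.atMost_Suc_shift head tail by simp
  finally show ?thesis .
qed

text \<open>No single finite sum equals \<open>D\<close> in all arities, so membership is checked in
  each arity against its own truncation.\<close>

lemma twisted_in_cochains: "D \<in> W.cochains 1"
  unfolding CY_def
proof (intro CollectI allI impI ballI)
  fix k y assume k: "1 \<le> k" "y \<in> Y k"
  have "(\<lambda>y xs. \<Sum>m\<le>k. G m y xs) \<in> W.cochains 1"
    by (intro W.cochains_sum W.ad_power_in_cochains diass_of_rep_in_cochains extend_in_cochains P_in_CY)
  from W.cochainsD[OF this k] show "graded_multilinear sW VW sW VW 1 k (D y)"
    unfolding graded_multilinear_def using twisted_eq_sum[OF k _ order.refl] by simp
qed

lemma twisted_square:
  assumes "1 \<le> s" "y \<in> Y s" "length xs = s"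
  shows "W.dia 1 D D y xs = 0"
  using assms by (intro W.exp_square[OF diass_of_rep_in_cochains extend_in_cochains[OF P_in_CY]
        diass_of_rep_square G_eq_0 twisted_eq_sum, where s = s and N = s]) auto

abbreviation "\<pi>P \<equiv> diass_of_operator sA VA \<mu> sM VM \<eta> P"

lemma twisted_Pair:
  assumes "1 \<le> k" "y \<in> Y k" "length us = k"
  shows "D y (map (Pair 0) us) = (0, \<pi>P y us)"
  using fst_twisted[OF assms] by (simp add: prod_eq_iff diass_of_operator_def)

lemma homogeneous_Pair: "homogeneous VM us ds \<Longrightarrow> homogeneous VW (map (Pair 0) us) ds"
  using subspace_0[OF subspace_component] by (auto simp: list_all2_conv_all_nth sum_grading_def)

lemma diass_of_operator_in_CY: "\<pi>P \<in> CY sM VM sM VM 1"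
  unfolding CY_def graded_multilinear_def
proof (intro CollectI allI impI ballI conjI)
  fix k y and xs zs :: "'m list" assume k: "1 \<le> k" "y \<in> Y k" "length xs + 1 + length zs = k"
  have "Vector_Spaces.linear sW sW (\<lambda>v. D y (map (Pair 0) xs @ v # map (Pair 0) zs))"
    by (rule graded_multilinear_slot[OF W.cochainsD[OF twisted_in_cochains k(1,2)]]) (use k in simp)
  moreover have "Vector_Spaces.linear sM sW (Pair 0)"
    by (simp add: linear_iff_add_scale W.vector_space_scale M.vector_space_scale sum_scale_def)
  ultimately have "Vector_Spaces.linear sM sW (\<lambda>u. D y (map (Pair 0) xs @ (0, u) # map (Pair 0) zs))"
    by (rule linear_map_comp)
  then show "Vector_Spaces.linear sM sM (\<lambda>u. \<pi>P y (xs @ u # zs))"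
    by (simp add: diass_of_operator_def linear_iff_add_scale M.vector_space_scale)
next
  fix k y and us :: "'m list" and ds assume k: "1 \<le> k" "y \<in> Y k" "length us = k" "homogeneous VM us ds"
  have "D y (map (Pair 0) us) \<in> VW (sum_list ds + 1)"
    by (rule graded_multilinear_degree[OF W.cochainsD[OF twisted_in_cochains k(1,2)]])
      (use k homogeneous_Pair in auto)
  then show "\<pi>P y us \<in> VM (sum_list ds + 1)"
    by (simp add: diass_of_operator_def sum_grading_def mem_Times_iff)
qed

text \<open>This is the M-component of the square of \<open>D\<close> on arguments from M. Since the
  inner value of \<open>D\<close> has no A-part, the outer \<open>D\<close> again sees only
  arguments from M, and both can be replaced by the restricted maps.\<close>

lemma diass_of_operator_identity:
  assumes n: "1 \<le> n" "y \<in> Y n" and us: "length us = n" "homogeneous VM us ds"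
  shows "(\<Sum>l = 1..n. \<Sum>i = 1..n - l + 1. sM ((-1) powi (sum_list (take (i - 1) ds)))
            (\<pi>P (tree_R0 i l y) (plug i l (\<pi>P (tree_Ri i l y)) us))) = 0" (is "?lhs = 0")
proof -
  let ?xs = "map (Pair 0) us"
  have xs: "length ?xs = n" using us by simp
  have plug: "plug i l (D (tree_Ri i l y)) ?xs = map (Pair 0) (plug i l (\<pi>P (tree_Ri i l y)) us)"
    if "l \<in> {1..n}" "i \<in> {1..n - l + 1}" for i l
  proof -
    have "tree_Ri i l y \<in> Y l" using n that tree_Ri_in_Y[of y "n - l + 1" l i] by simp
    moreover have "length (take l (drop (i - 1) us)) = l" using that us(1) by auto
    ultimately have "D (tree_Ri i l y) (map (Pair 0) (take l (drop (i - 1) us))) =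
        (0, \<pi>P (tree_Ri i l y) (take l (drop (i - 1) us)))"
      using that by (intro twisted_Pair[of l]) auto
    then show ?thesis by (simp add: plug_def take_map drop_map)
  qed
  have "0 = snd (W.dia 1 D D y ?xs)" using twisted_square[OF n xs] by simp
  also have "\<dots> = (\<Sum>l = 1..n. \<Sum>i = 1..n - l + 1. sM ((-1) powi (sum_list (take (i - 1) ds)))
      (snd (D (tree_R0 i l y) (plug i l (D (tree_Ri i l y)) ?xs))))"
    unfolding W.diamond_homogeneous[OF twisted_in_cochains n xs homogeneous_Pair[OF us(2)]] snd_sum
    by simp
  also have "\<dots> = ?lhs"
    by (intro sum.cong refl) (simp only: plug diass_of_operator_def)
  finally show ?thesis by simp
qed

end

theorem proposition8p8:
  fixes sA :: "'k::field_char_0 \<Rightarrow> 'a::ab_group_add \<Rightarrow> 'a" and VA :: "int \<Rightarrow> 'a set"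
    and \<mu> :: "'a list \<Rightarrow> 'a"
    and sM :: "'k \<Rightarrow> 'm::ab_group_add \<Rightarrow> 'm" and VM :: "int \<Rightarrow> 'm set"
    and \<eta> :: "'a list \<Rightarrow> 'm \<Rightarrow> 'a list \<Rightarrow> 'm"
    and P :: "pbtree \<Rightarrow> 'm list \<Rightarrow> 'a"
  assumes "ainf_algebra sA VA \<mu>"
    and "ainf_representation sA VA \<mu> sM VM \<eta>"
    and "homotopy_relative_averaging_operator sA VA \<mu> sM VM \<eta> P"
  shows "diass_inf_algebra sM VM (diass_of_operator sA VA \<mu> sM VM \<eta> P) \<and>
    (\<forall>k\<ge>1. \<forall>y\<in>Y k. \<forall>us. length us = k \<longrightarrow>
      twisted sA VA \<mu> sM VM \<eta> P y (map (Pair 0) us) =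
        (0, diass_of_operator sA VA \<mu> sM VM \<eta> P y us))"
proof -
  interpret homotopy_relative_averaging_operator sA VA \<mu> sM VM \<eta> P by fact
  have "diass_inf_algebra sM VM \<pi>P"
    by unfold_locales (fact diass_of_operator_in_CY, rule diass_of_operator_identity)
  then show ?thesis using twisted_Pair by blast
qed

end
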